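(* Let $(\bar M,g)$ be a Siklos spacetime with defining function $H=H(x_2,x_3,x_4)$ and constant $\beta$, let $F:M\to\bar M$ be a hypersurface with a Codazzi second fundamental form, and let $\xi$ be a unit normal vector field along $F$, with $g(\xi,\xi)=\varepsilon\in\{-1,1\}$. Let $\partial_i=\frac{\partial}{\partial x_i}$ ($i=1,\dots,4$) be the coordinate vector fields on $\bar M$. Then every point of $M$ has a neighborhood $U\subseteq M$ on which $$\xi=a\,\partial_1+\frac{x_3}{\beta}\cos\theta\,\partial_3+\frac{x_3}{\beta}\sin\theta\,\partial_4$$ for some functions $a,\theta:U\to\mathbb{R}$, where $$(H''_{33}-H''_{44})\sin(2\theta)=2H''_{34}\cos(2\theta)$$ on $U$. In particular, $M$ is necessarily timelike.
   Context: A Siklos spacetime is a 4-dimensional Lorentzian manifold $(\bar M,g)$ with global coordinates $(x_1,x_2,x_3,x_4)$ (where $x_3\neq 0$) and metric $g=\frac{\beta^2}{x_3^2}\left(2dx_1dx_2+H\,dx_2^2+dx_3^2+dx_4^2\right)$, where $H=H(x_2,x_3,x_4)$ is a smooth function (the defining function) and $\beta^2=-3/\Lambda$ with $\Lambda<0$ a real constant. Notation: $H'_i=\partial_iH$, $H''_{ij}=\partial_i\partial_jH$. In expressions on the hypersurface, $x_3$, $H''_{ij}$, etc. mean $x_3\circ F$, $H''_{ij}\circ F$, etc. A hypersurface is an isometric immersion $F:M^3\to\bar M^4$ of pseudo-Riemannian manifolds with unit normal $\xi$, $g(\xi,\xi)=\varepsilon\in\{-1,1\}$. With $\nabla,\nabla^M$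 the Levi-Civita connections of $\bar M,M$, the second fundamental form $h$ is the symmetric $(0,2)$-tensor defined by $\nabla_XY=\nabla^M_XY+h(X,Y)\xi$ for $X,Y$ tangent to $M$. Its covariant derivative is $(\nabla^Mh)(X,Y,Z)=X(h(Y,Z))-h(\nabla^M_XY,Z)-h(Y,\nabla^M_XZ)$. The hypersurface has a Codazzi second fundamental form if $\nabla^Mh$ is totally symmetric (equivalently, $R(X,Y)\xi=0$ for all $X,Y$ tangent to $M$, where $R$ is the curvature tensor of $\bar M$). $M$ timelike means that the induced metric on $M$ is Lorentzian, i.e. $g(\xi,\xi)=1$.
   Formalization: It is additionally assumed that no neighbourhood in the spacetime of a point of F(M) has constant sectional curvature; otherwise the claim fails, e.g. for H=0 and the spacelike hypersurface x_1-x_2=const, whose normal has a ∂_2 component. *)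

theory Defs
  imports "HOL-Analysis.Analysis"
begin

section \<open>Smooth maps between Euclidean spaces\<close>

fun Ck_on :: "nat \<Rightarrow> 'a::euclidean_space set \<Rightarrow> ('a \<Rightarrow> 'b::real_normed_vector) \<Rightarrow> bool" where
  "Ck_on 0 S f \<longleftrightarrow> continuous_on S f"
| "Ck_on (Suc k) S f \<longleftrightarrow>
     (\<forall>x\<in>S. f differentiable (at x)) \<and> (\<forall>v. Ck_on k S (\<lambda>x. frechet_derivative f (at x) v))"

text \<open>Only used for open sets; there the value of a derivative at a point of the set
  does not depend on the values of the function outside the set.\<close>

definition smooth_on :: "'a::euclidean_space set \<Rightarrow> ('a \<Rightarrow> 'b::real_normed_vector) \<Rightarrow> bool" where
  "smooth_on S f \<longleftrightarrow> (\<forall>k. Ck_on k S f)"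

definition partial :: "'n \<Rightarrow> (real^'n \<Rightarrow> real) \<Rightarrow> real^'n \<Rightarrow> real" where
  "partial i f x = frechet_derivative f (at x) (axis i 1)"


section \<open>Pseudo-Riemannian geometry in coordinates\<close>

text \<open>A metric on an open set of \<open>real^'n\<close> assigns to each point a symmetric bilinear form on
  \<open>real^'n\<close>.\<close>

type_synonym 'n metric = "real^'n \<Rightarrow> real^'n \<Rightarrow> real^'n \<Rightarrow> real"

definition nondegenerate :: "(real^'n \<Rightarrow> real^'n \<Rightarrow> real) \<Rightarrow> bool" where
  "nondegenerate b \<longleftrightarrow> (\<forall>u. u \<noteq> 0 \<longrightarrow> (\<exists>v. b u v \<noteq> 0))"

text \<open>A form is Lorentzian if it has a pseudo-orthonormal frame with exactly one timelike vector;
  the \<open>CARD('n)\<close> vectors of such a frame are automatically a basis.\<close>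

definition lorentzian :: "(real^'n \<Rightarrow> real^'n \<Rightarrow> real) \<Rightarrow> bool" where
  "lorentzian b \<longleftrightarrow> (\<exists>(e :: 'n \<Rightarrow> real^'n) i0. \<forall>i j.
     b (e i) (e j) = (if i = j then (if i = i0 then -1 else 1) else 0))"

definition gram :: "'n metric \<Rightarrow> real^'n \<Rightarrow> real^'n^'n" where
  "gram g x = (\<chi> i j. g x (axis i 1) (axis j 1))"

text \<open>\<open>christoffel g x u v\<close> is \<open>\<nabla>\<^bsub>u\<^esub> v\<close> at \<open>x\<close> for the constant vector fields \<open>u\<close> and \<open>v\<close>:
  the solution of the Koszul formula
  \<open>2 g(\<nabla>\<^bsub>u\<^esub> v, w) = u(g(v,w)) + v(g(u,w)) - w(g(u,v))\<close> for all coordinate fields \<open>w\<close>.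
  Its components are those of \<open>u\<^sup>i v\<^sup>j\<close> contracted with the usual Christoffel symbols.\<close>

definition christoffel :: "'n metric \<Rightarrow> real^'n \<Rightarrow> real^'n \<Rightarrow> real^'n \<Rightarrow> real^'n" where
  "christoffel g x u v = matrix_inv (gram g x) *v (\<chi> l. (1/2) *
     (frechet_derivative (\<lambda>y. g y v (axis l 1)) (at x) u
      + frechet_derivative (\<lambda>y. g y u (axis l 1)) (at x) v
      - frechet_derivative (\<lambda>y. g y u v) (at x) (axis l 1)))"

definition levi_civita ::
    "'n metric \<Rightarrow> (real^'n \<Rightarrow> real^'n) \<Rightarrow> (real^'n \<Rightarrow> real^'n) \<Rightarrow> real^'n \<Rightarrow> real^'n" where
  "levi_civita g X Y x = frechet_derivative Y (at x) (X x) + christoffel g x (X x) (Y x)"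

text \<open>\<open>R(u,v)w\<close> at \<open>x\<close>. Since \<open>R\<close> is a tensor it is enough to use the constant extensions of
  \<open>u\<close>, \<open>v\<close>, \<open>w\<close>, whose Lie brackets vanish.\<close>

definition curvature :: "'n metric \<Rightarrow> real^'n \<Rightarrow> real^'n \<Rightarrow> real^'n \<Rightarrow> real^'n \<Rightarrow> real^'n" where
  "curvature g x u v w =
     levi_civita g (\<lambda>_. u) (levi_civita g (\<lambda>_. v) (\<lambda>_. w)) x
     - levi_civita g (\<lambda>_. v) (levi_civita g (\<lambda>_. u) (\<lambda>_. w)) x"

definition constant_curvature_on :: "(real^'n) set \<Rightarrow> 'n metric \<Rightarrow> bool" where
  "constant_curvature_on W g \<longleftrightarrow> (\<exists>\<kappa>. \<forall>x\<in>W. \<forall>u v w.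
     curvature g x u v w = \<kappa> *\<^sub>R (g x v w *\<^sub>R u - g x u w *\<^sub>R v))"

definition pullback :: "'n metric \<Rightarrow> (real^'m \<Rightarrow> real^'n) \<Rightarrow> 'm metric" where
  "pullback g f x u v =
     g (f x) (frechet_derivative f (at x) u) (frechet_derivative f (at x) v)"

text \<open>\<open>\<nabla>\<^bsub>X\<^esub> V\<close> for a vector field \<open>V\<close> along a map \<open>f\<close>.\<close>

definition levi_civita_along ::
    "'n metric \<Rightarrow> (real^'m \<Rightarrow> real^'n) \<Rightarrow> (real^'m \<Rightarrow> real^'m) \<Rightarrow> (real^'m \<Rightarrow> real^'n)
      \<Rightarrow> real^'m \<Rightarrow> real^'n" where
  "levi_civita_along g f X V x =
     frechet_derivative V (at x) (X x)
     + christoffel g (f x) (frechet_derivative f (at x) (X x)) (V x)"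


section \<open>Manifolds given by an atlas\<close>

text \<open>The manifold is the whole topological space \<open>'p\<close>; a chart is a pair of an open set and a map
  that is only relevant on that set.\<close>

type_synonym ('p, 'm) chart = "'p set \<times> ('p \<Rightarrow> real^'m)"

definition smooth_atlas :: "('p::topological_space, 'm::finite) chart set \<Rightarrow> bool" where
  "smooth_atlas A \<longleftrightarrow>
     (\<Union>(U, \<phi>)\<in>A. U) = UNIV \<and>
     (\<forall>(U, \<phi>)\<in>A. open U \<and> open (\<phi> ` U) \<and> homeomorphism U (\<phi> ` U) \<phi> (inv_into U \<phi>)) \<and>
     (\<forall>(U, \<phi>)\<in>A. \<forall>(V, \<psi>)\<in>A. smooth_on (\<phi> ` (U \<inter> V)) (\<psi> \<circ> inv_into U \<phi>))"

definition smooth_map_on ::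
    "('p::topological_space, 'm::finite) chart set \<Rightarrow> 'p set \<Rightarrow> ('p \<Rightarrow> 'b::real_normed_vector) \<Rightarrow> bool" where
  "smooth_map_on A S f \<longleftrightarrow> (\<forall>(U, \<phi>)\<in>A. smooth_on (\<phi> ` (U \<inter> S)) (f \<circ> inv_into U \<phi>))"


section \<open>Hypersurfaces\<close>

text \<open>\<open>F\<close> is an immersion into \<open>(D, g)\<close>, and the metric on the source is the induced one,
  so that \<open>F\<close> is isometric; the induced metric is required to be nondegenerate.\<close>

definition hypersurface ::
    "(real^4) set \<Rightarrow> 4 metric \<Rightarrow> ('p::topological_space, 3) chart set \<Rightarrow> ('p \<Rightarrow> real^4) \<Rightarrow> bool" where
  "hypersurface D g A F \<longleftrightarrow>
     smooth_atlas A \<and> range F \<subseteq> D \<and> smooth_map_on A UNIV F \<and>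
     (\<forall>(U, \<phi>)\<in>A. \<forall>x\<in>\<phi> ` U.
        inj (frechet_derivative (F \<circ> inv_into U \<phi>) (at x)) \<and>
        nondegenerate (pullback g (F \<circ> inv_into U \<phi>) x))"

definition unit_normal ::
    "4 metric \<Rightarrow> ('p::topological_space, 3) chart set \<Rightarrow> ('p \<Rightarrow> real^4) \<Rightarrow> real \<Rightarrow> ('p \<Rightarrow> real^4) \<Rightarrow> bool" where
  "unit_normal g A F \<epsilon> \<xi> \<longleftrightarrow>
     smooth_map_on A UNIV \<xi> \<and>
     (\<forall>p. g (F p) (\<xi> p) (\<xi> p) = \<epsilon>) \<and>
     (\<forall>(U, \<phi>)\<in>A. \<forall>x\<in>\<phi> ` U. \<forall>u.
        g (F (inv_into U \<phi> x)) (\<xi> (inv_into U \<phi> x))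
          (frechet_derivative (F \<circ> inv_into U \<phi>) (at x) u) = 0)"

text \<open>Tangent vectors of the hypersurface at \<open>p\<close> are identified with their images in
  \<open>real^4\<close> under \<open>dF\<close>, so a \<open>(0,2)\<close>-tensor is a function \<open>h\<close> whose values \<open>h p u v\<close> matter
  only for \<open>u\<close>, \<open>v\<close> in the image of \<open>dF\<close> at \<open>p\<close>. In a chart it reads as follows.\<close>

definition tensor_in_chart ::
    "('p \<Rightarrow> real^4) \<Rightarrow> ('p \<Rightarrow> real^4 \<Rightarrow> real^4 \<Rightarrow> real) \<Rightarrow> 'p set \<Rightarrow> ('p \<Rightarrow> real^3)
      \<Rightarrow> real^3 \<Rightarrow> real^3 \<Rightarrow> real^3 \<Rightarrow> real" where
  "tensor_in_chart F h U \<phi> x u v =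
     h (inv_into U \<phi> x)
       (frechet_derivative (F \<circ> inv_into U \<phi>) (at x) u)
       (frechet_derivative (F \<circ> inv_into U \<phi>) (at x) v)"

text \<open>The Gauss formula \<open>\<nabla>\<^bsub>X\<^esub> Y = \<nabla>\<^sup>M\<^bsub>X\<^esub> Y + h(X,Y) \<xi>\<close> for all tangent fields. As \<open>\<xi>\<close> has no zeros it
  determines \<open>h\<close> on tangent vectors, and makes \<open>h\<close> smooth, bilinear and symmetric there.\<close>

definition second_fundamental_form ::
    "4 metric \<Rightarrow> ('p::topological_space, 3) chart set \<Rightarrow> ('p \<Rightarrow> real^4) \<Rightarrow> ('p \<Rightarrow> real^4)
      \<Rightarrow> ('p \<Rightarrow> real^4 \<Rightarrow> real^4 \<Rightarrow> real) \<Rightarrow> bool" where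
  "second_fundamental_form g A F \<xi> h \<longleftrightarrow>
     (\<forall>(U, \<phi>)\<in>A. \<forall>X Y. smooth_on (\<phi> ` U) X \<longrightarrow> smooth_on (\<phi> ` U) Y \<longrightarrow>
        (let f = F \<circ> inv_into U \<phi> in \<forall>x\<in>\<phi> ` U.
           levi_civita_along g f X (\<lambda>y. frechet_derivative f (at y) (Y y)) x =
             frechet_derivative f (at x) (levi_civita (pullback g f) X Y x)
             + tensor_in_chart F h U \<phi> x (X x) (Y x) *\<^sub>R \<xi> (inv_into U \<phi> x)))"

definition covariant_derivative_2tensor ::
    "'m metric \<Rightarrow> (real^'m \<Rightarrow> real^'m \<Rightarrow> real^'m \<Rightarrow> real)
      \<Rightarrow> (real^'m \<Rightarrow> real^'m) \<Rightarrow> (real^'m \<Rightarrow> real^'m) \<Rightarrow> (real^'m \<Rightarrow> real^'m) \<Rightarrow> real^'m \<Rightarrow> real" where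
  "covariant_derivative_2tensor g h X Y Z x =
     frechet_derivative (\<lambda>y. h y (Y y) (Z y)) (at x) (X x)
     - h x (levi_civita g X Y x) (Z x) - h x (Y x) (levi_civita g X Z x)"

text \<open>Total symmetry of \<open>\<nabla>\<^sup>M h\<close>; the two transpositions generate all permutations.\<close>

definition codazzi ::
    "4 metric \<Rightarrow> ('p::topological_space, 3) chart set \<Rightarrow> ('p \<Rightarrow> real^4)
      \<Rightarrow> ('p \<Rightarrow> real^4 \<Rightarrow> real^4 \<Rightarrow> real) \<Rightarrow> bool" where
  "codazzi g A F h \<longleftrightarrow>
     (\<forall>(U, \<phi>)\<in>A. \<forall>X Y Z.
        smooth_on (\<phi> ` U) X \<longrightarrow> smooth_on (\<phi> ` U) Y \<longrightarrow> smooth_on (\<phi> ` U) Z \<longrightarrow>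
        (let Dh = covariant_derivative_2tensor
                    (pullback g (F \<circ> inv_into U \<phi>)) (tensor_in_chart F h U \<phi>)
         in \<forall>x\<in>\<phi> ` U. Dh X Y Z x = Dh Y X Z x \<and> Dh X Y Z x = Dh X Z Y x))"

definition timelike_hypersurface ::
    "4 metric \<Rightarrow> ('p::topological_space, 3) chart set \<Rightarrow> ('p \<Rightarrow> real^4) \<Rightarrow> bool" where
  "timelike_hypersurface g A F \<longleftrightarrow>
     (\<forall>(U, \<phi>)\<in>A. \<forall>x\<in>\<phi> ` U. lorentzian (pullback g (F \<circ> inv_into U \<phi>) x))"


section \<open>Siklos spacetimes\<close>

definition siklos_metric :: "real \<Rightarrow> (real^4 \<Rightarrow> real) \<Rightarrow> 4 metric" where
  "siklos_metric \<beta> H x u v = \<beta>\<^sup>2 / (x$3)\<^sup>2 *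
     (u$1 * v$2 + u$2 * v$1 + H x * (u$2 * v$2) + u$3 * v$3 + u$4 * v$4)"

text \<open>The global coordinates identify the spacetime with an open subset \<open>D\<close> of \<open>real^4\<close>. The
  defining function is a function on \<open>D\<close> whose values do not depend on the first coordinate.\<close>

definition siklos_spacetime :: "(real^4) set \<Rightarrow> (real^4 \<Rightarrow> real) \<Rightarrow> real \<Rightarrow> real \<Rightarrow> bool" where
  "siklos_spacetime D H \<Lambda> \<beta> \<longleftrightarrow>
     open D \<and> (\<forall>x\<in>D. x$3 \<noteq> 0) \<and> smooth_on D H \<and>
     (\<forall>x\<in>D. \<forall>y\<in>D. x$2 = y$2 \<and> x$3 = y$3 \<and> x$4 = y$4 \<longrightarrow> H x = H y) \<and>
     \<Lambda> < 0 \<and> \<beta>\<^sup>2 = -3 / \<Lambda>"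

end

(*
  The curvature of a Siklos metric is that of constant curvature -1/\<beta>\<^sup>2 plus the term
  (\<beta>\<^sup>2 / (2 x3\<^sup>2)) \<Sum> A_ij (dx2 \<and> dx_i) (dx2 \<and> dx_j), i, j \<in> {3, 4}, where A_ij is the Hessian of H in
  x3, x4 minus (H_3 / x3) times the identity. By the Codazzi equation, R(X,Y)\<xi> vanishes for
  tangent X, Y. If dx2(\<xi>) \<noteq> 0 at some point, this forces A = 0 there and on a neighbourhood in M,
  which is transversal to \<partial>_1; since A does not depend on x1, the ambient metric has constant curvature
  on an open set meeting M, which is excluded. So dx2(\<xi>) = 0, the (3,4)-part of \<xi> is nonzero,
  hence \<epsilon> = 1, and the same condition says that this part is an eigenvector of A.
*)
theory Submission
  imports Defs
begin

section \<open>Smooth maps\<close>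

text \<open>Constant curvature has to be excluded: there \<open>R(X,Y)\<xi>\<close> vanishes for
  tangent X, Y of any hypersurface, and for H = 0 the hypersurface x1 = x2 even has a timelike
  normal. The obstacle is that the exclusion concerns open sets of the ambient space, while the
  Codazzi condition speaks only about points of M; independence of x1 bridges this gap. The case
  distinction is about the null field \<partial>_1: g(\<partial>_1, \<xi>) is (\<beta>/x3)^2
  dx2(\<xi>), so dx2(\<xi>) = 0 says that \<partial>_1 is tangent to M. If it is not, tangent
  vectors have arbitrary components 2, 3, 4 and test every entry of A. If it is, tangent vectors
  with dx2 = 0 have a (3,4)-part orthogonal to that of \<xi>, and what remains is A(Y, \<xi>) = 0
  for such Y. In polar coordinates this is the equation in 2\<theta>, where multiples of the
  identity drop out, so that the Hessian of H replaces A. The angle is determined only modulo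
  2\<pi>; a smooth branch is chosen near each point, starting from its value there.\<close>

lemma has_derivative_frechet:
  "f differentiable (at x) \<Longrightarrow> (f has_derivative frechet_derivative f (at x)) (at x)"
  by (simp add: frechet_derivative_works)

lemma frechet_derivative_eq:
  "(f has_derivative f') (at x) \<Longrightarrow> frechet_derivative f (at x) = f'"
  by (metis frechet_derivative_at)

lemma Ck_on_cong:
  assumes "open S" "\<And>x. x \<in> S \<Longrightarrow> f x = g x" "Ck_on k S f"
  shows "Ck_on k S g"
  using assms(2,3)
proof (induction k arbitrary: f g)
  case 0
  then show ?case by (simp cong: continuous_on_cong)
next
  case (Suc k)
  have der: "(g has_derivative frechet_derivative f (at x)) (at x)" if "x \<in> S" for x
    by (rule has_derivative_transform_within_open[OF _ \<open>open S\<close> that, where f = f])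
      (use Suc.prems that has_derivative_frechet in auto)
  then have "g differentiable (at x)" if "x \<in> S" for x
    using that by (auto simp: differentiable_def)
  moreover have "Ck_on k S (\<lambda>x. frechet_derivative g (at x) v)" for v
    by (rule Suc.IH[of "\<lambda>x. frechet_derivative f (at x) v"])
      (use Suc.prems frechet_derivative_eq[OF der] in auto)
  ultimately show ?case by simp
qed

text \<open>Engine of the inductions on the order below: the derivative may be given by any formula
  valid on S, and the order of the formula is then computed from its pieces.\<close>

lemma Ck_on_SucI:
  assumes "open S" "\<And>x. x \<in> S \<Longrightarrow> (f has_derivative f' x) (at x)"
    and "\<And>v. Ck_on k S (\<lambda>x. f' x v)"
  shows "Ck_on (Suc k) S f"
proof -
  have "Ck_on k S (\<lambda>x. frechet_derivative f (at x) v)" for v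
    by (rule Ck_on_cong[OF assms(1) _ assms(3)[of v]]) (simp add: frechet_derivative_eq[OF assms(2)])
  then show ?thesis
    using assms(2) by (auto simp: differentiable_def)
qed

lemma Ck_on_SucD:
  assumes "Ck_on (Suc k) S f"
  shows "Ck_on k S f"
  using assms
proof (induction k arbitrary: f)
  case 0
  then show ?case
    by (simp add: continuous_at_imp_continuous_on differentiable_imp_continuous_within)
next
  case (Suc k)
  then show ?case by (metis Ck_on.simps(2))
qed

lemma Ck_on_subset: "Ck_on k S f \<Longrightarrow> T \<subseteq> S \<Longrightarrow> Ck_on k T f"
  by (induction k arbitrary: f) (auto intro: continuous_on_subset)

lemma Ck_on_const: "Ck_on k S (\<lambda>_. c)"
  by (induction k arbitrary: c) (auto simp: frechet_derivative_const)

lemma Ck_on_add: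
  assumes "open S" "Ck_on k S f" "Ck_on k S g"
  shows "Ck_on k S (\<lambda>x. f x + g x)"
  using assms(2,3)
proof (induction k arbitrary: f g)
  case 0
  then show ?case by (simp add: continuous_on_add)
next
  case (Suc k)
  show ?case
    by (rule Ck_on_SucI[OF \<open>open S\<close>, where f' = "\<lambda>x v. frechet_derivative f (at x) v + frechet_derivative g (at x) v"])
      (use Suc in \<open>auto intro!: has_derivative_add has_derivative_frechet\<close>)
qed

lemma (in bounded_linear) Ck_on:
  assumes "open S" "Ck_on k S g"
  shows "Ck_on k S (\<lambda>x. f (g x))"
  using assms(2)
proof (induction k arbitrary: g)
  case 0
  then show ?case by (simp add: continuous_on)
next
  case (Suc k)
  show ?case
    by (rule Ck_on_SucI[OF \<open>open S\<close>, where f' = "\<lambda>x v. f (frechet_derivative g (at x) v)"])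
      (use Suc in \<open>auto intro!: has_derivative has_derivative_frechet\<close>)
qed

lemma (in bounded_bilinear) Ck_on:
  assumes "open S" "Ck_on k S f" "Ck_on k S g"
  shows "Ck_on k S (\<lambda>x. prod (f x) (g x))"
  using assms(2,3)
proof (induction k arbitrary: f g)
  case 0
  then show ?case by (simp add: continuous_on)
next
  case (Suc k)
  \<comment> \<open>The product rule leaves one factor undifferentiated, so its order has to be
    lowered from k + 1 to k.\<close>
  note low = Ck_on_SucD[OF Suc.prems(1)] Ck_on_SucD[OF Suc.prems(2)]
  show ?case
    by (rule Ck_on_SucI[OF \<open>open S\<close>, where f' = "\<lambda>x v. prod (f x) (frechet_derivative g (at x) v)
            + prod (frechet_derivative f (at x) v) (g x)"])
      (use Suc low in \<open>auto intro!: FDERIV has_derivative_frechet Ck_on_add[OF \<open>open S\<close>]\<close>)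
qed

lemmas Ck_on_mult = bounded_bilinear.Ck_on[OF bounded_bilinear_mult]

lemma Ck_on_inverse:
  fixes f :: "'a::euclidean_space \<Rightarrow> real"
  assumes "open S" "\<And>x. x \<in> S \<Longrightarrow> f x \<noteq> 0" "Ck_on k S f"
  shows "Ck_on k S (\<lambda>x. inverse (f x))"
  using assms(3)
proof (induction k)
  case 0
  then show ?case using assms(2) by (simp add: continuous_on_inverse)
next
  case (Suc k)
  \<comment> \<open>The derivative -f'/f^2 contains 1/f itself, for which the induction hypothesis
    gives order k.\<close>
  have low: "Ck_on k S (\<lambda>x. inverse (f x))"
    using Suc.IH Ck_on_SucD[OF Suc.prems] by blast
  show ?case
  proof (rule Ck_on_SucI[OF \<open>open S\<close>])
    show "((\<lambda>x. inverse (f x)) has_derivative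
        (\<lambda>v. (-1) * (inverse (f x) * frechet_derivative f (at x) v * inverse (f x)))) (at x)"
      if "x \<in> S" for x
      using that Suc.prems assms(2)
      by (auto intro!: derivative_eq_intros has_derivative_frechet)
    show "Ck_on k S (\<lambda>x. (-1) * (inverse (f x) * frechet_derivative f (at x) v * inverse (f x)))" for v
      using Suc.prems low by (intro Ck_on_mult[OF \<open>open S\<close>] Ck_on_const) auto
  qed
qed

text \<open>No induction: the derivative f'/(1 + f^2) is rational in f and f', so one step reduces
  to products and inverses. Serves the smoothness of the angle \<theta>.\<close>

lemma Ck_on_arctan:
  fixes f :: "'a::euclidean_space \<Rightarrow> real"
  assumes "open S" "Ck_on k S f"
  shows "Ck_on k S (\<lambda>x. arctan (f x))"
proof (cases k)
  case 0
  then show ?thesis using assms(2) by (auto intro: continuous_intros)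
next
  case (Suc k')
  have low: "Ck_on k' S f"
    using assms(2) Suc Ck_on_SucD by blast
  have "1 + f x * f x \<noteq> 0" for x
    by (simp add: sum_squares_eq_zero_iff add_nonneg_eq_0_iff)
  then have inv: "Ck_on k' S (\<lambda>x. inverse (1 + f x * f x))"
    by (intro Ck_on_inverse Ck_on_add Ck_on_const Ck_on_mult assms(1) low) auto
  show ?thesis
    unfolding Suc
  proof (rule Ck_on_SucI[OF \<open>open S\<close>])
    show "((\<lambda>x. arctan (f x)) has_derivative
        (\<lambda>v. frechet_derivative f (at x) v * inverse (1 + f x * f x))) (at x)" if "x \<in> S" for x
      using that assms(2) Suc
      by (auto intro!: derivative_eq_intros has_derivative_frechet simp: power2_eq_square)
    show "Ck_on k' S (\<lambda>x. frechet_derivative f (at x) v * inverse (1 + f x * f x))" for v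
      using assms(2) Suc inv by (intro Ck_on_mult[OF \<open>open S\<close>]) auto
  qed
qed

lemma smooth_on_differentiable: "smooth_on S f \<Longrightarrow> x \<in> S \<Longrightarrow> f differentiable (at x)"
  unfolding smooth_on_def by (metis Ck_on.simps(2))

lemma smooth_on_has_derivative:
  "smooth_on S f \<Longrightarrow> x \<in> S \<Longrightarrow> (f has_derivative frechet_derivative f (at x)) (at x)"
  by (rule has_derivative_frechet[OF smooth_on_differentiable])

lemma smooth_on_frechet_derivative: "smooth_on S f \<Longrightarrow> smooth_on S (\<lambda>x. frechet_derivative f (at x) v)"
  unfolding smooth_on_def by (metis Ck_on.simps(2))

lemma smooth_on_continuous: "smooth_on S f \<Longrightarrow> continuous_on S f"
  unfolding smooth_on_def by (metis Ck_on.simps(1))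

lemma smooth_on_const: "smooth_on S (\<lambda>_. c)"
  by (simp add: smooth_on_def Ck_on_const)

lemma smooth_on_subset: "smooth_on S f \<Longrightarrow> T \<subseteq> S \<Longrightarrow> smooth_on T f"
  by (meson Ck_on_subset smooth_on_def)

lemma smooth_on_add:
  "open S \<Longrightarrow> smooth_on S f \<Longrightarrow> smooth_on S g \<Longrightarrow> smooth_on S (\<lambda>x. f x + g x)"
  by (simp add: smooth_on_def Ck_on_add)

lemma smooth_on_mult:
  fixes f g :: "'a::euclidean_space \<Rightarrow> real"
  shows "open S \<Longrightarrow> smooth_on S f \<Longrightarrow> smooth_on S g \<Longrightarrow> smooth_on S (\<lambda>x. f x * g x)"
  by (simp add: smooth_on_def Ck_on_mult)

lemma smooth_on_divide:
  fixes f g :: "'a::euclidean_space \<Rightarrow> real"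
  assumes "open S" "smooth_on S f" "smooth_on S g" "\<And>x. x \<in> S \<Longrightarrow> g x \<noteq> 0"
  shows "smooth_on S (\<lambda>x. f x / g x)"
  using assms by (simp add: smooth_on_def divide_inverse Ck_on_mult Ck_on_inverse)

lemma smooth_on_arctan:
  fixes f :: "'a::euclidean_space \<Rightarrow> real"
  shows "open S \<Longrightarrow> smooth_on S f \<Longrightarrow> smooth_on S (\<lambda>x. arctan (f x))"
  by (simp add: smooth_on_def Ck_on_arctan)

lemma smooth_on_bounded_linear:
  "bounded_linear f \<Longrightarrow> open S \<Longrightarrow> smooth_on S g \<Longrightarrow> smooth_on S (\<lambda>x. f (g x))"
  by (simp add: smooth_on_def bounded_linear.Ck_on)

section \<open>Symmetry of second derivatives\<close>

lemma second_difference_eq: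
  fixes f :: "'a::real_normed_vector \<Rightarrow> real"
  assumes f': "\<And>y. y \<in> S \<Longrightarrow> (f has_derivative f' y) (at y)"
    and f'': "\<And>y. y \<in> S \<Longrightarrow> ((\<lambda>y. f' y u) has_derivative f'' y) (at y)"
    and S: "\<And>r s. r \<in> {0..t} \<Longrightarrow> s \<in> {0..t} \<Longrightarrow> x + r *\<^sub>R u + s *\<^sub>R v \<in> S"
    and "0 < t"
  shows "\<exists>r\<in>{0<..<t}. \<exists>s\<in>{0<..<t}.
    f (x + t *\<^sub>R u + t *\<^sub>R v) - f (x + t *\<^sub>R u) - f (x + t *\<^sub>R v) + f x
      = t\<^sup>2 * f'' (x + r *\<^sub>R u + s *\<^sub>R v) v"
proof -
  \<comment> \<open>The second difference is the increment of \<open>k\<close> over [0, t]; the mean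
    value theorem is applied first in direction u to \<open>k\<close>, then in direction v to the
    resulting derivative.\<close>
  define k where "k r = f (x + r *\<^sub>R u + t *\<^sub>R v) - f (x + r *\<^sub>R u)" for r
  have lin: "linear (f' y)" "linear (f'' y)" if "y \<in> S" for y
    using f'[OF that] f''[OF that] has_derivative_linear by blast+
  have S0: "x + r *\<^sub>R u \<in> S" if "r \<in> {0..t}" for r
    using S[OF that, of 0] \<open>0 < t\<close> by simp
  have "(k has_real_derivative f' (x + r *\<^sub>R u + t *\<^sub>R v) u - f' (x + r *\<^sub>R u) u) (at r)"
    if "r \<in> {0..t}" for r
  proof -
    have "((\<lambda>r. f (x + r *\<^sub>R u + t *\<^sub>R v)) has_derivative (\<lambda>d. f' (x + r *\<^sub>R u + t *\<^sub>R v) (d *\<^sub>R u))) (at r)"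
      by (rule has_derivative_compose[OF _ f'])
        (use that \<open>0 < t\<close> in \<open>auto intro!: derivative_eq_intros S\<close>)
    moreover have "((\<lambda>r. f (x + r *\<^sub>R u)) has_derivative (\<lambda>d. f' (x + r *\<^sub>R u) (d *\<^sub>R u))) (at r)"
      by (rule has_derivative_compose[OF _ f'])
        (use that in \<open>auto intro!: derivative_eq_intros S0\<close>)
    ultimately show ?thesis
      unfolding k_def has_field_derivative_def
      by (rule has_derivative_eq_rhs[OF has_derivative_diff])
        (use that \<open>0 < t\<close> in \<open>auto simp: fun_eq_iff linear_scale[OF lin(1)] S S0 left_diff_distrib\<close>)
  qed
  then obtain r where r: "0 < r" "r < t"
    "k t - k 0 = t * (f' (x + r *\<^sub>R u + t *\<^sub>R v) u - f' (x + r *\<^sub>R u) u)"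
    using MVT2[OF \<open>0 < t\<close>, of k "\<lambda>r. f' (x + r *\<^sub>R u + t *\<^sub>R v) u - f' (x + r *\<^sub>R u) u"] by auto
  have "((\<lambda>s. f' (x + r *\<^sub>R u + s *\<^sub>R v) u) has_real_derivative f'' (x + r *\<^sub>R u + s *\<^sub>R v) v) (at s)"
    if "s \<in> {0..t}" for s
  proof -
    have mem: "x + r *\<^sub>R u + s *\<^sub>R v \<in> S"
      using r that by (auto intro: S)
    have "((\<lambda>s. f' (x + r *\<^sub>R u + s *\<^sub>R v) u) has_derivative
        (\<lambda>d. f'' (x + r *\<^sub>R u + s *\<^sub>R v) (d *\<^sub>R v))) (at s)"
      by (rule has_derivative_compose[where f = "\<lambda>s. x + r *\<^sub>R u + s *\<^sub>R v" and g = "\<lambda>y. f' y u", OF _ f''[OF mem]])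
        (auto intro!: derivative_eq_intros)
    then show ?thesis
      unfolding has_field_derivative_def
      by (rule has_derivative_eq_rhs) (auto simp: fun_eq_iff linear_scale[OF lin(2)[OF mem]])
  qed
  then obtain s where s: "0 < s" "s < t"
    "f' (x + r *\<^sub>R u + t *\<^sub>R v) u - f' (x + r *\<^sub>R u) u = t * f'' (x + r *\<^sub>R u + s *\<^sub>R v) v"
    using MVT2[OF \<open>0 < t\<close>, of "\<lambda>s. f' (x + r *\<^sub>R u + s *\<^sub>R v) u"
        "\<lambda>s. f'' (x + r *\<^sub>R u + s *\<^sub>R v) v"] by auto
  have "k t - k 0 = t\<^sup>2 * f'' (x + r *\<^sub>R u + s *\<^sub>R v) v"
    using r(3) s(3) by (simp add: power2_eq_square)
  then show ?thesis
    using r s unfolding k_def by (intro bexI[of _ r] bexI[of _ s]) auto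
qed

text \<open>The second difference with step t is symmetric in u and v, and equals t^2 times either
  mixed derivative at some point of the parallelogram. If the two differed at x, continuity would
  contradict this for small t.\<close>

lemma mixed_derivatives_commute_real:
  fixes f :: "'a::real_normed_vector \<Rightarrow> real"
  assumes "open S" "x \<in> S"
    and f': "\<And>y. y \<in> S \<Longrightarrow> (f has_derivative f' y) (at y)"
    and fu: "\<And>y. y \<in> S \<Longrightarrow> ((\<lambda>y. f' y u) has_derivative fu y) (at y)"
    and fv: "\<And>y. y \<in> S \<Longrightarrow> ((\<lambda>y. f' y v) has_derivative fv y) (at y)"
    and cont: "continuous_on S (\<lambda>y. fu y v)" "continuous_on S (\<lambda>y. fv y u)"
  shows "fu x v = fv x u"
proof (rule ccontr)
  assume ne: "fu x v \<noteq> fv x u"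
  define e where "e = dist (fu x v) (fv x u) / 2"
  have "0 < e" using ne by (simp add: e_def)
  have "((\<lambda>y. fu y v) \<longlongrightarrow> fu x v) (nhds x)" "((\<lambda>y. fv y u) \<longlongrightarrow> fv x u) (nhds x)"
    using cont assms(1,2) continuous_on_eq_continuous_at tendsto_at_iff_tendsto_nhds isCont_def by metis+
  then have "\<forall>\<^sub>F y in nhds x. y \<in> S \<and> dist (fu y v) (fu x v) < e \<and> dist (fv y u) (fv x u) < e"
    using \<open>0 < e\<close> assms(1,2)
    by (intro eventually_conj eventually_nhds_in_open tendstoD)
  then obtain d where "0 < d"
    and d: "\<And>y. dist y x < d \<Longrightarrow> y \<in> S \<and> dist (fu y v) (fu x v) < e \<and> dist (fv y u) (fv x u) < e"
    unfolding eventually_nhds_metric by blast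
  \<comment> \<open>Small enough for the parallelogram spanned by t u and t v at x to lie in the
    ball of radius d; the summand 1 covers u = v = 0.\<close>
  define t where "t = d / (norm u + norm v + 1)"
  have "0 < t" using \<open>0 < d\<close> by (simp add: t_def add_nonneg_pos)
  have small: "dist (x + r *\<^sub>R u + s *\<^sub>R v) x < d" if "r \<in> {0..t}" "s \<in> {0..t}" for r s
  proof -
    have "norm (r *\<^sub>R u + s *\<^sub>R v) \<le> r * norm u + s * norm v"
      using that by (intro norm_triangle_le) auto
    also have "\<dots> \<le> t * norm u + t * norm v"
      using that by (intro add_mono mult_right_mono) auto
    also have "\<dots> < t * (norm u + norm v + 1)"
      using \<open>0 < t\<close> by (simp add: algebra_simps)
    also have "\<dots> = d"
      unfolding t_def using add_nonneg_pos[OF add_nonneg_nonneg[OF norm_ge_zero[of u] norm_ge_zero[of v]] zero_less_one]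
      by simp
    finally show ?thesis by (simp add: dist_norm add.assoc)
  qed
  have mem: "x + r *\<^sub>R u + s *\<^sub>R v \<in> S" and mem': "x + r *\<^sub>R v + s *\<^sub>R u \<in> S"
    if "r \<in> {0..t}" "s \<in> {0..t}" for r s
    using d[OF small[OF that]] d[OF small[OF that(2,1)]] by (simp_all add: ac_simps)
  let ?\<Delta> = "f (x + t *\<^sub>R u + t *\<^sub>R v) - f (x + t *\<^sub>R u) - f (x + t *\<^sub>R v) + f x"
  obtain r s where rs: "r \<in> {0<..<t}" "s \<in> {0<..<t}" "?\<Delta> = t\<^sup>2 * fu (x + r *\<^sub>R u + s *\<^sub>R v) v"
    using second_difference_eq[where S = S and x = x, OF f' fu mem \<open>0 < t\<close>] by blast
  obtain r' s' where rs': "r' \<in> {0<..<t}" "s' \<in> {0<..<t}"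
    "f (x + t *\<^sub>R v + t *\<^sub>R u) - f (x + t *\<^sub>R v) - f (x + t *\<^sub>R u) + f x
      = t\<^sup>2 * fv (x + r' *\<^sub>R v + s' *\<^sub>R u) u"
    using second_difference_eq[where S = S and x = x, OF f' fv mem' \<open>0 < t\<close>] by blast
  have "f (x + t *\<^sub>R v + t *\<^sub>R u) - f (x + t *\<^sub>R v) - f (x + t *\<^sub>R u) + f x = ?\<Delta>"
    by (simp add: ac_simps)
  then have "t\<^sup>2 * fu (x + r *\<^sub>R u + s *\<^sub>R v) v = t\<^sup>2 * fv (x + r' *\<^sub>R v + s' *\<^sub>R u) u"
    using rs(3) rs'(3) by argo
  moreover have "x + r' *\<^sub>R v + s' *\<^sub>R u = x + s' *\<^sub>R u + r' *\<^sub>R v"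
    by (simp add: ac_simps)
  ultimately have "fu (x + r *\<^sub>R u + s *\<^sub>R v) v = fv (x + s' *\<^sub>R u + r' *\<^sub>R v) u"
    using \<open>0 < t\<close> by simp
  moreover have "dist (fu (x + r *\<^sub>R u + s *\<^sub>R v) v) (fu x v) < e"
    "dist (fv (x + s' *\<^sub>R u + r' *\<^sub>R v) u) (fv x u) < e"
    using d small rs rs' by auto
  ultimately show False
    using dist_triangle_half_r[of _ "fu x v" "dist (fu x v) (fv x u)" "fv x u"]
    unfolding e_def by (metis less_irrefl)
qed

lemma mixed_derivatives_commute:
  fixes f :: "'a::euclidean_space \<Rightarrow> 'b::euclidean_space"
  assumes "open S" "smooth_on S f" "x \<in> S"
  shows "frechet_derivative (\<lambda>y. frechet_derivative f (at y) u) (at x) v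
    = frechet_derivative (\<lambda>y. frechet_derivative f (at y) v) (at x) u"
proof (rule euclidean_eqI)
  fix b :: 'b
  have der: "((\<lambda>y. g y \<bullet> b) has_derivative (\<lambda>w. frechet_derivative g (at y) w \<bullet> b)) (at y)"
    if "smooth_on S g" "y \<in> S" for g :: "'a \<Rightarrow> 'b" and y
    by (rule has_derivative_inner_left[OF smooth_on_has_derivative[OF that]])
  have cont: "continuous_on S (\<lambda>y. g y \<bullet> b)" if "smooth_on S g" for g
    by (intro continuous_intros smooth_on_continuous that)
  show "frechet_derivative (\<lambda>y. frechet_derivative f (at y) u) (at x) v \<bullet> b
    = frechet_derivative (\<lambda>y. frechet_derivative f (at y) v) (at x) u \<bullet> b"
    by (rule mixed_derivatives_commute_real[OF assms(1,3) der[where g = f]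
          der[where g = "\<lambda>y. frechet_derivative f (at y) u"]
          der[where g = "\<lambda>y. frechet_derivative f (at y) v"]])
      (auto intro!: cont smooth_on_frechet_derivative assms)
qed

section \<open>The Codazzi equation\<close>

lemma bilinear_expand:
  fixes B :: "'a::euclidean_space \<Rightarrow> 'b::euclidean_space \<Rightarrow> 'c::real_vector"
  assumes "bilinear B"
  shows "B a b = (\<Sum>i\<in>Basis. \<Sum>j\<in>Basis. ((a \<bullet> i) * (b \<bullet> j)) *\<^sub>R B i j)"
proof -
  have "B a b = B (\<Sum>i\<in>Basis. (a \<bullet> i) *\<^sub>R i) (\<Sum>j\<in>Basis. (b \<bullet> j) *\<^sub>R j)"
    by (simp add: euclidean_representation)
  also have "\<dots> = (\<Sum>(i, j)\<in>Basis \<times> Basis. B ((a \<bullet> i) *\<^sub>R i) ((b \<bullet> j) *\<^sub>R j))"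
    by (rule bilinear_sum[OF assms])
  also have "\<dots> = (\<Sum>i\<in>Basis. \<Sum>j\<in>Basis. ((a \<bullet> i) * (b \<bullet> j)) *\<^sub>R B i j)"
    by (simp add: sum.cartesian_product bilinear_lmul[OF assms] bilinear_rmul[OF assms] mult.commute)
  finally show ?thesis .
qed

text \<open>The linearity identities for \<open>B\<close> hold in a neighbourhood of x and can be
  differentiated; uniqueness of derivatives passes them on to \<open>B'\<close>.\<close>

lemma bilinear_derivative:
  fixes B :: "'x::real_normed_vector \<Rightarrow> 'a::euclidean_space \<Rightarrow> 'b::euclidean_space \<Rightarrow> 'c::real_normed_vector"
  assumes "open D" "x \<in> D" and bil: "\<And>x. x \<in> D \<Longrightarrow> bilinear (B x)"
    and B': "\<And>a b. ((\<lambda>x. B x a b) has_derivative (\<lambda>u. B' u a b)) (at x)"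
  shows "bilinear (B' u)"
proof -
  have uniq: "B' u a b = d u"
    if "((\<lambda>x. B x a b) has_derivative d) (at x)" for a b d
    using has_derivative_unique[OF B' that] by meson
  have "B' u (a + a') b = B' u a b + B' u a' b" "B' u b' (c + c') = B' u b' c + B' u b' c'"
    "B' u (r *\<^sub>R a) b = r *\<^sub>R B' u a b" "B' u b' (r *\<^sub>R c) = r *\<^sub>R B' u b' c" for a a' b b' c c' r
    by (rule uniq, rule has_derivative_transform_within_open[OF _ \<open>open D\<close> \<open>x \<in> D\<close>],
        rule has_derivative_add[OF B' B'] has_derivative_scaleR_right[OF B'],
        simp add: bilinear_ladd[OF bil] bilinear_radd[OF bil] bilinear_lmul[OF bil] bilinear_rmul[OF bil])+
  then show ?thesis
    by (auto simp: bilinear_def intro!: linearI)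
qed

text \<open>A product rule that starts from the derivatives of \<open>B x a b\<close> for fixed a,
  b, the form in which the derivatives of a metric and of its Christoffel symbols are given.
  Expansion in the standard bases reduces it to finite sums of products.\<close>

lemma has_derivative_bilinear_family:
  fixes B :: "'x::real_normed_vector \<Rightarrow> 'a::euclidean_space \<Rightarrow> 'b::euclidean_space \<Rightarrow> 'c::real_normed_vector"
  assumes "open D" "f t \<in> D" and bil: "\<And>x. x \<in> D \<Longrightarrow> bilinear (B x)"
    and B': "\<And>a b. ((\<lambda>x. B x a b) has_derivative (\<lambda>u. B' u a b)) (at (f t))"
    and f: "(f has_derivative f') (at t)"
    and p: "(p has_derivative p') (at t)" and q: "(q has_derivative q') (at t)"
  shows "((\<lambda>t. B (f t) (p t) (q t)) has_derivative
      (\<lambda>d. B' (f' d) (p t) (q t) + B (f t) (p' d) (q t) + B (f t) (p t) (q' d))) (at t)"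
proof (rule has_derivative_transform_eventually[where s = UNIV])
  note bil' = bilinear_derivative[OF assms(1,2) bil B']
  have comp: "((\<lambda>t. B (f t) i j) has_derivative (\<lambda>d. B' (f' d) i j)) (at t)" for i j
    by (rule has_derivative_compose[where g = "\<lambda>x. B x i j", OF f B'])
  show "((\<lambda>t. \<Sum>i\<in>Basis. \<Sum>j\<in>Basis. ((p t \<bullet> i) * (q t \<bullet> j)) *\<^sub>R B (f t) i j) has_derivative
      (\<lambda>d. B' (f' d) (p t) (q t) + B (f t) (p' d) (q t) + B (f t) (p t) (q' d))) (at t within UNIV)"
    by (rule has_derivative_eq_rhs, (rule has_derivative_sum has_derivative_scaleR has_derivative_mult
          has_derivative_inner_left p q comp)+)
      (auto simp: fun_eq_iff bilinear_expand[OF bil', of _ "p t" "q t"]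
        bilinear_expand[OF bil[OF assms(2)], of _ "q t"] bilinear_expand[OF bil[OF assms(2)], of "p t"]
        sum.distrib[symmetric] algebra_simps)
  \<comment> \<open>Bilinearity, and with it the expansion, is available on D only; by continuity f
    stays in D near t.\<close>
  have "(f \<longlongrightarrow> f t) (at t)"
    using has_derivative_continuous[OF f] by (simp add: continuous_at)
  from topological_tendstoD[OF this assms(1,2)]
  show "\<forall>\<^sub>F t in at t within UNIV. (\<Sum>i\<in>Basis. \<Sum>j\<in>Basis. ((p t \<bullet> i) * (q t \<bullet> j)) *\<^sub>R B (f t) i j)
      = B (f t) (p t) (q t)"
    by eventually_elim (simp add: bilinear_expand[OF bil, of _ "p _" "q _"])
  show "(\<Sum>i\<in>Basis. \<Sum>j\<in>Basis. ((p t \<bullet> i) * (q t \<bullet> j)) *\<^sub>R B (f t) i j) = B (f t) (p t) (q t)"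
    by (simp add: bilinear_expand[OF bil[OF assms(2)], of "p t" "q t"])
qed auto

lemma linear_axis_eqI:
  fixes f g :: "real^'n \<Rightarrow> 'b::real_vector"
  assumes "linear f" "linear g" "\<And>i. f (axis i 1) = g (axis i 1)"
  shows "f = g"
  by (rule linear_eq_stdbasis[OF assms(1,2)]) (use assms(3) in \<open>auto simp: Basis_vec_def\<close>)

lemma levi_civita_const: "levi_civita g (\<lambda>_. u) (\<lambda>_. v) = (\<lambda>x. christoffel g x u v)"
  by (simp add: levi_civita_def fun_eq_iff frechet_derivative_const)

lemma curvature_eq_christoffel:
  "curvature g x u v w =
     frechet_derivative (\<lambda>y. christoffel g y v w) (at x) u + christoffel g x u (christoffel g x v w)
     - (frechet_derivative (\<lambda>y. christoffel g y u w) (at x) v + christoffel g x v (christoffel g x u w))"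
  unfolding curvature_def levi_civita_const by (simp add: levi_civita_def)

section \<open>Levi-Civita calculus of a nondegenerate metric\<close>

locale pseudo_riemannian =
  fixes D :: "(real^'n) set" and g :: "'n metric"
  assumes open_D: "open D"
    and bilinear_metric: "\<And>x. x \<in> D \<Longrightarrow> bilinear (g x)"
    and metric_commute: "\<And>x u v. x \<in> D \<Longrightarrow> g x u v = g x v u"
    and nondegenerate_metric: "\<And>x. x \<in> D \<Longrightarrow> nondegenerate (g x)"
    and metric_differentiable: "\<And>x u v. x \<in> D \<Longrightarrow> (\<lambda>y. g y u v) differentiable (at x)"
begin

definition dg :: "real^'n \<Rightarrow> real^'n \<Rightarrow> real^'n \<Rightarrow> real^'n \<Rightarrow> real" where
  "dg x a u v = frechet_derivative (\<lambda>y. g y u v) (at x) a"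

lemma metric_has_derivative:
  "x \<in> D \<Longrightarrow> ((\<lambda>y. g y u v) has_derivative (\<lambda>a. dg x a u v)) (at x)"
  unfolding dg_def by (rule has_derivative_frechet[OF metric_differentiable])

lemma linear_dg: "x \<in> D \<Longrightarrow> linear (\<lambda>a. dg x a u v)"
  using has_derivative_linear[OF metric_has_derivative] .

lemma bilinear_dg: "x \<in> D \<Longrightarrow> bilinear (dg x a)"
  by (rule bilinear_derivative[OF open_D _ bilinear_metric metric_has_derivative])

lemma dg_commute:
  assumes "x \<in> D" shows "dg x a u v = dg x a v u"
proof -
  have "((\<lambda>y. g y u v) has_derivative (\<lambda>a. dg x a v u)) (at x)"
    by (rule has_derivative_transform_within_open[OF metric_has_derivative open_D])
      (use assms in \<open>auto intro: metric_commute\<close>)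
  from has_derivative_unique[OF this metric_has_derivative[OF assms]] show ?thesis by (simp add: fun_eq_iff)
qed

lemma metric_eqI:
  assumes "x \<in> D" "\<And>w. g x u w = g x v w"
  shows "u = v"
proof (rule ccontr)
  assume "u \<noteq> v"
  then obtain w where "g x (u - v) w \<noteq> 0"
    using nondegenerate_metric[OF assms(1)] unfolding nondegenerate_def by (metis right_minus_eq)
  then show False
    using assms(2)[of w] by (simp add: bilinear_lsub[OF bilinear_metric[OF assms(1)]])
qed

lemma gram_mult:
  assumes "x \<in> D"
  shows "(gram g x *v a) $ l = g x a (axis l 1)"
proof -
  have "g x a (axis l 1) = g x (axis l 1) (\<Sum>j\<in>UNIV. a $ j *\<^sub>R axis j 1)"
    using basis_expansion[of a] by (simp add: metric_commute[OF assms] scalar_mult_eq_scaleR)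
  also have "\<dots> = (\<Sum>j\<in>UNIV. a $ j * g x (axis l 1) (axis j 1))"
    using bilinear_metric[OF assms] by (simp add: bilinear_def linear_sum linear_scale)
  finally show ?thesis
    by (simp add: matrix_vector_mult_def gram_def mult.commute)
qed

lemma invertible_gram:
  assumes "x \<in> D" shows "invertible (gram g x)"
proof -
  have "a = 0" if "gram g x *v a = 0" for a
  proof (rule metric_eqI[OF assms])
    have "g x a (axis l 1) = g x 0 (axis l 1)" for l
      using that gram_mult[OF assms, of a l] bilinear_lzero[OF bilinear_metric[OF assms]] by simp
    then have "g x a = g x 0"
      using bilinear_metric[OF assms] by (intro linear_axis_eqI) (auto simp: bilinear_def)
    then show "g x a w = g x 0 w" for w by simp
  qed
  then show ?thesis
    unfolding invertible_left_inverse matrix_left_invertible_ker by blast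
qed

text \<open>The definition imposes this formula for coordinate fields w; both sides are linear in
  w.\<close>

lemma koszul:
  assumes "x \<in> D"
  shows "2 * g x (christoffel g x u v) w = dg x u v w + dg x v u w - dg x w u v"
proof -
  have inv: "gram g x ** matrix_inv (gram g x) = mat 1"
    using someI_ex[OF invertible_gram[OF assms, unfolded invertible_def]] by (simp add: matrix_inv_def)
  have "gram g x *v christoffel g x u v = (\<chi> l. (1/2) * (dg x u v (axis l 1) + dg x v u (axis l 1) - dg x (axis l 1) u v))"
    unfolding christoffel_def dg_def by (simp add: matrix_vector_mul_assoc inv)
  then have "2 * g x (christoffel g x u v) (axis l 1)
      = dg x u v (axis l 1) + dg x v u (axis l 1) - dg x (axis l 1) u v" for l
    using gram_mult[OF assms, of "christoffel g x u v" l] by simp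
  moreover have "linear (\<lambda>w. dg x u v w + dg x v u w - dg x w u v)"
    using linear_dg[OF assms] bilinear_dg[OF assms]
    by (intro linear_compose_sub linear_compose_add) (auto simp: bilinear_def)
  moreover have "linear (\<lambda>w. 2 * g x (christoffel g x u v) w)"
    using bilinear_metric[OF assms] linear_compose_scale_right[of "g x (christoffel g x u v)" 2]
    by (simp add: bilinear_def)
  ultimately have "(\<lambda>w. 2 * g x (christoffel g x u v) w) = (\<lambda>w. dg x u v w + dg x v u w - dg x w u v)"
    by (intro linear_axis_eqI) auto
  then show ?thesis by meson
qed

text \<open>Nondegeneracy makes the solution of the Koszul formula unique. Symmetry, bilinearity and
  later the explicit Christoffel symbols are all obtained by verifying that formula.\<close>

lemma christoffel_eqI:
  assumes "x \<in> D" "\<And>w. 2 * g x c w = dg x u v w + dg x v u w - dg x w u v"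
  shows "christoffel g x u v = c"
  by (rule metric_eqI[OF assms(1)]) (use koszul[OF assms(1)] assms(2) in \<open>metis mult_cancel_left zero_neq_numeral\<close>)

lemma christoffel_commute: "x \<in> D \<Longrightarrow> christoffel g x u v = christoffel g x v u"
  by (rule christoffel_eqI) (auto simp: koszul dg_commute[of x _ u v])

lemma bilinear_christoffel:
  assumes "x \<in> D" shows "bilinear (christoffel g x)"
proof -
  note rules = bilinear_ladd[OF bilinear_metric[OF assms]] bilinear_lmul[OF bilinear_metric[OF assms]]
    bilinear_radd[OF bilinear_dg[OF assms]] bilinear_rmul[OF bilinear_dg[OF assms]]
    bilinear_ladd[OF bilinear_dg[OF assms]] bilinear_lmul[OF bilinear_dg[OF assms]]
    linear_add[OF linear_dg[OF assms]] linear_scale[OF linear_dg[OF assms]]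
  have add: "christoffel g x u (v + v') = christoffel g x u v + christoffel g x u v'" for u v v'
    by (rule christoffel_eqI[OF assms]) (simp add: rules distrib_left koszul[OF assms])
  have scale: "christoffel g x u (r *\<^sub>R v) = r *\<^sub>R christoffel g x u v" for u v r
    using koszul[OF assms, of u v, THEN arg_cong[where f = "(*) r"]]
    by (intro christoffel_eqI[OF assms]) (simp add: rules distrib_left right_diff_distrib mult.left_commute)
  show ?thesis
    unfolding bilinear_def
    using add scale by (auto intro!: linearI simp: christoffel_commute[OF assms, of _ "_ :: real^'n"])
qed

text \<open>In the sum of the Koszul formulas for a, u tested on v and for a, v tested on u, the
  derivatives of the metric along u and v cancel.\<close>

lemma metric_compatible:
  assumes "x \<in> D"
  shows "dg x a u v = g x (christoffel g x a u) v + g x u (christoffel g x a v)"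
  using koszul[OF assms, of a u v] koszul[OF assms, of a v u] dg_commute[OF assms]
    metric_commute[OF assms, of u "christoffel g x a v"] by (smt (verit))

lemma metric_along_has_derivative:
  assumes "f x \<in> D" "(f has_derivative f') (at x)"
    and "(V has_derivative V') (at x)" "(W has_derivative W') (at x)"
  shows "((\<lambda>y. g (f y) (V y) (W y)) has_derivative
    (\<lambda>u. g (f x) (V' u + christoffel g (f x) (f' u) (V x)) (W x)
      + g (f x) (V x) (W' u + christoffel g (f x) (f' u) (W x)))) (at x)"
  by (rule has_derivative_eq_rhs[OF has_derivative_bilinear_family[OF open_D assms(1)
          bilinear_metric metric_has_derivative[OF assms(1)] assms(2-4)]])
    (auto simp: fun_eq_iff metric_compatible[OF assms(1)] bilinear_ladd[OF bilinear_metric[OF assms(1)]]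
      bilinear_radd[OF bilinear_metric[OF assms(1)]])

text \<open>The Codazzi equation for constant fields u, v, w in the chart; \<open>G\<close> stands
  for the induced connection, and its symmetry for vanishing torsion. By the Gauss formula, h(v,w)
  is \<epsilon> times the product of \<xi> with the derivative of df(w) along v. Differentiating
  once more along u yields a second covariant derivative, whose antisymmetrisation is curvature, and
  a Weingarten term h(u, G v w), which cancels against the connection terms of the covariant
  derivative of h.\<close>

lemma codazzi_equation:
  fixes f :: "real^'m \<Rightarrow> real^'n"
  assumes "open S" "x \<in> S" and f: "smooth_on S f" "f ` S \<subseteq> D"
    and \<Gamma>: "\<And>u v. (\<lambda>y. christoffel g y u v) differentiable (at (f x))"
    and \<xi>: "smooth_on S \<xi>" "\<And>y. y \<in> S \<Longrightarrow> g (f y) (\<xi> y) (\<xi> y) = \<epsilon>" "\<epsilon>\<^sup>2 = 1"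
      "\<And>y u. y \<in> S \<Longrightarrow> g (f y) (\<xi> y) (frechet_derivative f (at y) u) = 0"
    and gauss: "\<And>y u v. y \<in> S \<Longrightarrow>
      levi_civita_along g f (\<lambda>_. u) (\<lambda>y. frechet_derivative f (at y) v) y
        = frechet_derivative f (at y) (G y u v) + h y u v *\<^sub>R \<xi> y"
    and G: "\<And>u v. G x u v = G x v u"
  shows "(frechet_derivative (\<lambda>y. h y v w) (at x) u - h x (G x u v) w - h x v (G x u w))
      - (frechet_derivative (\<lambda>y. h y u w) (at x) v - h x (G x v u) w - h x u (G x v w))
    = \<epsilon> * g (f x) (curvature g (f x) (frechet_derivative f (at x) u) (frechet_derivative f (at x) v)
        (frechet_derivative f (at x) w)) (\<xi> x)"
proof -
  \<comment> \<open>\<open>F1\<close>, \<open>F2\<close>, \<open>F3\<close> are iterated derivatives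
    of f. \<open>K u v\<close> is the covariant derivative of df(v) along u, \<open>K'\<close> the
    plain and \<open>DK\<close> the covariant derivative of \<open>K\<close> at x, and
    \<open>D\<xi>\<close> the covariant derivative of the normal.\<close>
  define F1 where "F1 = (\<lambda>v y. frechet_derivative f (at y) v)"
  define F2 where "F2 = (\<lambda>u v y. frechet_derivative (F1 v) (at y) u)"
  define F3 where "F3 = (\<lambda>u v w y. frechet_derivative (F2 v w) (at y) u)"
  define \<Gamma>f where "\<Gamma>f = (\<lambda>y. christoffel g (f y))"
  define d\<Gamma> where "d\<Gamma> = (\<lambda>a u v. frechet_derivative (\<lambda>y. christoffel g y u v) (at (f x)) a)"
  define \<xi>' where "\<xi>' = frechet_derivative \<xi> (at x)"
  define K where "K = (\<lambda>u v y. F2 u v y + \<Gamma>f y (F1 u y) (F1 v y))"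
  define D\<xi> where "D\<xi> = (\<lambda>u. \<xi>' u + \<Gamma>f x (F1 u x) (\<xi> x))"
  define K' where "K' = (\<lambda>u v w. F3 u v w x
    + (d\<Gamma> (F1 u x) (F1 v x) (F1 w x) + \<Gamma>f x (F2 u v x) (F1 w x) + \<Gamma>f x (F1 v x) (F2 u w x)))"
  define DK where "DK = (\<lambda>u v w. K' u v w + \<Gamma>f x (F1 u x) (K v w x))"
  have fx: "f x \<in> D" and fD: "\<And>y. y \<in> S \<Longrightarrow> f y \<in> D"
    using f(2) \<open>x \<in> S\<close> by auto
  note bil = bilinear_metric[OF fx] bilinear_christoffel[OF fx, folded \<Gamma>f_def]
  have smooth: "smooth_on S (F1 v)" "smooth_on S (F2 u v)" for u v
    unfolding F2_def F1_def by (intro smooth_on_frechet_derivative f)+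
  have f': "(f has_derivative (\<lambda>v. F1 v x)) (at x)"
    using smooth_on_has_derivative[OF f(1) \<open>x \<in> S\<close>] by (simp add: F1_def)
  have F1': "(F1 v has_derivative (\<lambda>u. F2 u v x)) (at x)" for v
    using smooth_on_has_derivative[OF smooth(1) \<open>x \<in> S\<close>] by (simp add: F2_def)
  have F2': "(F2 v w has_derivative (\<lambda>u. F3 u v w x)) (at x)" for v w
    using smooth_on_has_derivative[OF smooth(2) \<open>x \<in> S\<close>] by (simp add: F3_def)
  have \<xi>': "(\<xi> has_derivative \<xi>') (at x)"
    using smooth_on_has_derivative[OF \<xi>(1) \<open>x \<in> S\<close>] by (simp add: \<xi>'_def)
  have \<Gamma>': "((\<lambda>y. christoffel g y u v) has_derivative (\<lambda>a. d\<Gamma> a u v)) (at (f x))" for u v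
    unfolding d\<Gamma>_def by (rule has_derivative_frechet[OF \<Gamma>])
  have K_eq: "K u v y = F1 (G y u v) y + h y u v *\<^sub>R \<xi> y" if "y \<in> S" for u v y
    using gauss[OF that, of u v] by (simp add: K_def F2_def F1_def \<Gamma>f_def levi_civita_along_def)
  have h_eq: "h y u v = \<epsilon> * g (f y) (K u v y) (\<xi> y)" if "y \<in> S" for u v y
  proof -
    note b = bilinear_metric[OF fD[OF that]]
    have "g (f y) (F1 w y) (\<xi> y) = 0" for w
      using \<xi>(4)[OF that] metric_commute[OF fD[OF that]] by (simp add: F1_def)
    then show ?thesis
      using \<xi>(3) by (simp add: K_eq[OF that] bilinear_ladd[OF b] bilinear_lmul[OF b] \<xi>(2)[OF that]
          power2_eq_square mult.left_commute)
  qed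
  have g\<xi>K: "g (f x) (\<xi> x) (K u v x) = \<epsilon> * h x u v" for u v
    using \<xi>(3) metric_commute[OF fx]
    by (simp add: h_eq[OF \<open>x \<in> S\<close>] mult.assoc[symmetric] power2_eq_square)
  have D\<xi>_\<xi>: "g (f x) (\<xi> x) (D\<xi> u) = 0" for u
  proof -
    have "((\<lambda>y. g (f y) (\<xi> y) (\<xi> y)) has_derivative
        (\<lambda>u. g (f x) (D\<xi> u) (\<xi> x) + g (f x) (\<xi> x) (D\<xi> u))) (at x)"
      using metric_along_has_derivative[OF fx f' \<xi>' \<xi>'] by (simp add: D\<xi>_def \<Gamma>f_def)
    then have "((\<lambda>y. \<epsilon>) has_derivative (\<lambda>u. g (f x) (D\<xi> u) (\<xi> x) + g (f x) (\<xi> x) (D\<xi> u))) (at x)"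
      by (rule has_derivative_transform_within_open[OF _ \<open>open S\<close> \<open>x \<in> S\<close>]) (simp add: \<xi>)
    from has_derivative_unique[OF this has_derivative_const]
    have "g (f x) (D\<xi> u) (\<xi> x) + g (f x) (\<xi> x) (D\<xi> u) = 0" by meson
    then show ?thesis using metric_commute[OF fx, of "\<xi> x" "D\<xi> u"] by simp
  qed
  have D\<xi>_F1: "g (f x) (F1 l x) (D\<xi> u) = - (\<epsilon> * h x u l)" for u l
  proof -
    have "((\<lambda>y. g (f y) (\<xi> y) (F1 l y)) has_derivative
        (\<lambda>u. g (f x) (D\<xi> u) (F1 l x) + g (f x) (\<xi> x) (K u l x))) (at x)"
      using metric_along_has_derivative[OF fx f' \<xi>' F1'[of l]] by (simp add: D\<xi>_def K_def \<Gamma>f_def)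
    then have "((\<lambda>y. 0) has_derivative (\<lambda>u. g (f x) (D\<xi> u) (F1 l x) + g (f x) (\<xi> x) (K u l x))) (at x)"
      by (rule has_derivative_transform_within_open[OF _ \<open>open S\<close> \<open>x \<in> S\<close>]) (simp add: \<xi>(4) F1_def)
    from has_derivative_unique[OF this has_derivative_const]
    have "g (f x) (D\<xi> u) (F1 l x) + g (f x) (\<xi> x) (K u l x) = 0" by meson
    then show ?thesis using metric_commute[OF fx, of "F1 l x" "D\<xi> u"] g\<xi>K[of u l]
      by simp
  qed
  have K': "(K v w has_derivative (\<lambda>u. K' u v w)) (at x)" for v w
    unfolding K_def K'_def \<Gamma>f_def
    by (intro has_derivative_add F2' has_derivative_bilinear_family[OF open_D fx bilinear_christoffel \<Gamma>' f' F1' F1'])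
  have dh: "frechet_derivative (\<lambda>y. h y v w) (at x) u
    = \<epsilon> * g (f x) (DK u v w) (\<xi> x) - h x u (G x v w)" for u v w
  proof -
    have "((\<lambda>y. g (f y) (K v w y) (\<xi> y)) has_derivative
        (\<lambda>u. g (f x) (DK u v w) (\<xi> x) + g (f x) (K v w x) (D\<xi> u))) (at x)"
      using metric_along_has_derivative[OF fx f' K' \<xi>'] by (simp add: D\<xi>_def DK_def \<Gamma>f_def)
    then have "((\<lambda>y. \<epsilon> * g (f y) (K v w y) (\<xi> y)) has_derivative
        (\<lambda>u. \<epsilon> * (g (f x) (DK u v w) (\<xi> x) + g (f x) (K v w x) (D\<xi> u)))) (at x)"
      by (rule has_derivative_mult_right)
    then have "((\<lambda>y. h y v w) has_derivative
        (\<lambda>u. \<epsilon> * (g (f x) (DK u v w) (\<xi> x) + g (f x) (K v w x) (D\<xi> u)))) (at x)"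
      by (rule has_derivative_transform_within_open[OF _ \<open>open S\<close> \<open>x \<in> S\<close>]) (simp add: h_eq)
    from frechet_derivative_eq[OF this]
    have "frechet_derivative (\<lambda>y. h y v w) (at x) u
      = \<epsilon> * (g (f x) (DK u v w) (\<xi> x) + g (f x) (K v w x) (D\<xi> u))" by simp
    \<comment> \<open>Gauss splits \<open>K\<close> into a tangential part, on which
      \<open>D\<xi>\<close> acts by the Weingarten formula, and a multiple of \<xi>, which is
      orthogonal to \<open>D\<xi>\<close> because \<xi> has constant length.\<close>
    moreover have "g (f x) (K v w x) (D\<xi> u) = - (\<epsilon> * h x u (G x v w))"
      by (simp add: K_eq[OF \<open>x \<in> S\<close>] bilinear_ladd[OF bil(1)] bilinear_lmul[OF bil(1)] D\<xi>_F1 D\<xi>_\<xi>)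
    ultimately have "frechet_derivative (\<lambda>y. h y v w) (at x) u
      = \<epsilon> * g (f x) (DK u v w) (\<xi> x) - \<epsilon>\<^sup>2 * h x u (G x v w)"
      by (simp add: right_diff_distrib power2_eq_square)
    then show ?thesis using \<xi>(3) by simp
  qed
  have F2_commute: "F2 u v x = F2 v u x" for u v
    unfolding F2_def F1_def by (rule mixed_derivatives_commute[OF \<open>open S\<close> f(1) \<open>x \<in> S\<close>])
  have F3_commute: "F3 u v w x = F3 v u w x" for u v w
    unfolding F3_def F2_def by (rule mixed_derivatives_commute[OF \<open>open S\<close> smooth(1) \<open>x \<in> S\<close>])
  \<comment> \<open>Third derivatives of f cancel by their symmetry, and so do the terms mixing
    Christoffel symbols with second derivatives of f; what remains is the coordinate expression of
    the curvature.\<close>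
  have "DK u v w - DK v u w = curvature g (f x) (F1 u x) (F1 v x) (F1 w x)"
    by (simp add: curvature_eq_christoffel DK_def K'_def K_def
        bilinear_radd[OF bilinear_christoffel[OF fx]] F3_commute[of u v] F2_commute[of u v] d\<Gamma>_def \<Gamma>f_def)
  then have "g (f x) (DK u v w) (\<xi> x) - g (f x) (DK v u w) (\<xi> x)
    = g (f x) (curvature g (f x) (F1 u x) (F1 v x) (F1 w x)) (\<xi> x)"
    by (metis bilinear_lsub[OF bil(1)])
  then show ?thesis
    by (simp add: dh G[of u v] F1_def flip: right_diff_distrib)
qed

text \<open>Dimension count: nondegeneracy makes the orthogonal complement of n a proper subspace,
  so its dimension is at most that of the range of the injective map L, which it contains.\<close>

lemma normal_complement_eq_range:
  fixes L :: "real^'m \<Rightarrow> real^'n"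
  assumes "x \<in> D" "linear L" "inj L" "n \<noteq> 0" "CARD('n) = Suc CARD('m)"
    and "\<And>u. g x n (L u) = 0"
  shows "range L = {w. g x n w = 0}"
proof (rule subspace_dim_equal)
  have lin: "linear (g x n)"
    using bilinear_metric[OF assms(1)] by (simp add: bilinear_def)
  show "subspace (range L)"
    by (rule linear_subspace_image[OF assms(2) subspace_UNIV])
  show "subspace {w. g x n w = 0}"
    by (rule linear_subspace_kernel[OF lin])
  show "range L \<subseteq> {w. g x n w = 0}"
    using assms(6) by auto
  have "{w. g x n w = 0} \<noteq> UNIV"
    using nondegenerate_metric[OF assms(1)] \<open>n \<noteq> 0\<close> unfolding nondegenerate_def by auto
  then have "dim {w. g x n w = 0} < CARD('n)"
    using dim_psubset[of "{w. g x n w = 0}" UNIV] \<open>subspace {w. g x n w = 0}\<close>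
    by (metis DIM_cart DIM_real dim_UNIV mult.right_neutral span_UNIV span_eq_iff top.not_eq_extremum)
  moreover have "dim (range L) = CARD('m)"
    using dim_image_eq[OF assms(2), of UNIV] assms(3) by (simp add: dim_UNIV)
  ultimately show "dim (range L) \<ge> dim {w. g x n w = 0}"
    using assms(5) by simp
qed

end

section \<open>Curvature of Siklos spacetimes\<close>

text \<open>A combination of the coordinate fields, so that derivatives can be taken coefficient by
  coefficient.\<close>

definition vec4 :: "real \<Rightarrow> real \<Rightarrow> real \<Rightarrow> real \<Rightarrow> real^4" where
  "vec4 a b c d = a *\<^sub>R axis 1 1 + b *\<^sub>R axis 2 1 + c *\<^sub>R axis 3 1 + d *\<^sub>R axis 4 1"

lemma vec4_nth [simp]:
  "vec4 a b c d $ 1 = a" "vec4 a b c d $ 2 = b" "vec4 a b c d $ 3 = c" "vec4 a b c d $ 4 = d"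
  by (simp_all add: vec4_def axis_def)

locale siklos =
  fixes D :: "(real^4) set" and H :: "real^4 \<Rightarrow> real" and \<Lambda> \<beta> :: real
  assumes siklos_spacetime: "siklos_spacetime D H \<Lambda> \<beta>"
begin

abbreviation g :: "4 metric" where "g \<equiv> siklos_metric \<beta> H"

text \<open>Compares any two points of D on a line in direction \<partial>_1, even if D meets that
  line in a disconnected set; this is more than \<open>partial 1 k = 0\<close>, and
  \<open>flat_at_x1_independent\<close> relies on it.\<close>

definition x1_independent :: "(real^4 \<Rightarrow> real) \<Rightarrow> bool" where
  "x1_independent k \<longleftrightarrow>
     (\<forall>x\<in>D. \<forall>y\<in>D. x$2 = y$2 \<and> x$3 = y$3 \<and> x$4 = y$4 \<longrightarrow> k x = k y)"

lemma open_D: "open D" and x3_nonzero: "x \<in> D \<Longrightarrow> x$3 \<noteq> 0" and smooth_H: "smooth_on D H"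
  and x1_independent_H: "x1_independent H"
  using siklos_spacetime unfolding siklos_spacetime_def x1_independent_def by blast+

lemma \<beta>_nonzero: "\<beta> \<noteq> 0"
proof -
  have "\<Lambda> < 0" "\<beta>\<^sup>2 = -3 / \<Lambda>"
    using siklos_spacetime unfolding siklos_spacetime_def by blast+
  then show ?thesis by auto
qed

lemma x1_independentD:
  "x1_independent k \<Longrightarrow> x \<in> D \<Longrightarrow> y \<in> D \<Longrightarrow> x$2 = y$2 \<Longrightarrow> x$3 = y$3 \<Longrightarrow> x$4 = y$4 \<Longrightarrow> k x = k y"
  unfolding x1_independent_def by blast

lemma x1_independent_frechet_derivative:
  assumes "x1_independent k" "smooth_on D k"
  shows "x1_independent (\<lambda>x. frechet_derivative k (at x) v)"
  unfolding x1_independent_def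
proof (intro ballI impI)
  fix x y assume xy: "x \<in> D" "y \<in> D" "x$2 = y$2 \<and> x$3 = y$3 \<and> x$4 = y$4"
  \<comment> \<open>The vector y - x is a multiple of the first axis vector; on T both z and its
    translate lie in D, so k is invariant under the translation there.\<close>
  define T where "T = D \<inter> (\<lambda>z. z + (y - x)) -` D"
  have "open T"
    unfolding T_def by (intro open_Int open_D open_vimage continuous_intros)
  have "((\<lambda>z. z + (y - x)) has_derivative (\<lambda>v. v)) (at x)"
    by (auto intro!: derivative_eq_intros)
  then have "((\<lambda>z. k (z + (y - x))) has_derivative frechet_derivative k (at y)) (at x)"
    by (rule has_derivative_compose) (use smooth_on_has_derivative[OF assms(2) xy(2)] in simp)
  then have "(k has_derivative frechet_derivative k (at y)) (at x)"
    by (rule has_derivative_transform_within_open[OF _ \<open>open T\<close>])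
      (use xy in \<open>auto simp: T_def intro!: x1_independentD[OF assms(1)]\<close>)
  then show "frechet_derivative k (at x) v = frechet_derivative k (at y) v"
    by (simp add: frechet_derivative_eq)
qed

lemma x1_independent_partial: "x1_independent k \<Longrightarrow> smooth_on D k \<Longrightarrow> x1_independent (partial i k)"
  unfolding partial_def[abs_def] by (rule x1_independent_frechet_derivative)

lemma smooth_partial: "smooth_on D k \<Longrightarrow> smooth_on D (partial i k)"
  unfolding partial_def[abs_def] by (rule smooth_on_frechet_derivative)

lemma partial_1_eq_0:
  assumes "x1_independent k" "smooth_on D k" "x \<in> D"
  shows "partial 1 k x = 0"
proof -
  define T where "T = (\<lambda>t. x + t *\<^sub>R axis 1 1) -` D"
  have "open T"
    unfolding T_def by (intro open_vimage open_D continuous_intros)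
  have "((\<lambda>t. x + t *\<^sub>R axis 1 1) has_derivative (\<lambda>t. t *\<^sub>R axis 1 1)) (at 0)"
    by (auto intro!: derivative_eq_intros)
  then have "((\<lambda>t. k (x + t *\<^sub>R axis 1 1)) has_derivative
      (\<lambda>t. frechet_derivative k (at x) (t *\<^sub>R axis 1 1))) (at 0)"
    by (rule has_derivative_compose) (use smooth_on_has_derivative[OF assms(2,3)] in simp)
  then have "((\<lambda>t. k x) has_derivative (\<lambda>t. frechet_derivative k (at x) (t *\<^sub>R axis 1 1))) (at (0::real))"
    by (rule has_derivative_transform_within_open[OF _ \<open>open T\<close>])
      (use assms(3) in \<open>auto simp: T_def axis_def intro!: x1_independentD[OF assms(1)]\<close>)
  from has_derivative_unique[OF this has_derivative_const]
  have "frechet_derivative k (at x) (t *\<^sub>R axis 1 1) = 0" for t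
    by meson
  from this[of 1] show ?thesis by (simp add: partial_def)
qed

lemma x1_independent_has_derivative:
  assumes "x1_independent k" "smooth_on D k" "x \<in> D"
  shows "(k has_derivative (\<lambda>a. partial 2 k x * a$2 + partial 3 k x * a$3 + partial 4 k x * a$4)) (at x)"
proof (rule has_derivative_eq_rhs[OF smooth_on_has_derivative[OF assms(2,3)]], rule ext)
  fix a :: "real^4"
  have lin: "linear (frechet_derivative k (at x))"
    using smooth_on_has_derivative[OF assms(2,3)] has_derivative_linear by blast
  have "frechet_derivative k (at x) a = frechet_derivative k (at x) (\<Sum>i\<in>UNIV. a $ i *\<^sub>R axis i 1)"
    using basis_expansion[of a] by (simp add: scalar_mult_eq_scaleR)
  also have "\<dots> = (\<Sum>i\<in>UNIV. a $ i * partial i k x)"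
    by (simp add: linear_sum[OF lin] linear_scale[OF lin] partial_def)
  finally show "frechet_derivative k (at x) a
      = partial 2 k x * a$2 + partial 3 k x * a$3 + partial 4 k x * a$4"
    by (simp add: sum_4 partial_1_eq_0[OF assms] mult.commute)
qed

lemma partial_commute: "x \<in> D \<Longrightarrow> partial i (partial j H) x = partial j (partial i H) x"
  unfolding partial_def[abs_def] by (rule mixed_derivatives_commute[OF open_D smooth_H])

definition dH :: "real^4 \<Rightarrow> real^4 \<Rightarrow> real" where
  "dH x a = partial 2 H x * a$2 + partial 3 H x * a$3 + partial 4 H x * a$4"

definition ddH :: "4 \<Rightarrow> real^4 \<Rightarrow> real^4 \<Rightarrow> real" where
  "ddH i x a = partial 2 (partial i H) x * a$2 + partial 3 (partial i H) x * a$3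
    + partial 4 (partial i H) x * a$4"

lemma H_has_derivative: "x \<in> D \<Longrightarrow> (H has_derivative dH x) (at x)"
  using x1_independent_has_derivative[OF x1_independent_H smooth_H]
  unfolding dH_def[abs_def] .

lemma partial_H_has_derivative: "x \<in> D \<Longrightarrow> (partial i H has_derivative ddH i x) (at x)"
  using x1_independent_has_derivative[OF x1_independent_partial smooth_partial, OF x1_independent_H smooth_H smooth_H]
  unfolding ddH_def[abs_def] .

text \<open>The pp-wave metric to which the Siklos metric is conformal, with factor
  (\<beta>/x3)^2.\<close>

definition bH :: "real^4 \<Rightarrow> real^4 \<Rightarrow> real^4 \<Rightarrow> real" where
  "bH x u v = u$1 * v$2 + u$2 * v$1 + H x * (u$2 * v$2) + u$3 * v$3 + u$4 * v$4"

lemma bH_has_derivative: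
  "x \<in> D \<Longrightarrow> ((\<lambda>y. bH y u v) has_derivative (\<lambda>a. dH x a * (u$2 * v$2))) (at x)"
  unfolding bH_def by (auto intro!: derivative_eq_intros H_has_derivative)

lemma nth_has_derivative: "((\<lambda>y. y $ i) has_derivative (\<lambda>a. a $ i)) (at x)"
  by (rule bounded_linear_imp_has_derivative[OF bounded_linear_vec_nth])

text \<open>With 1/x3 as an atom whose derivative is -r^2 dx3, the tensor components below are
  polynomials in \<open>r\<close>, H, its derivatives and the vector components.\<close>

definition r :: "real^4 \<Rightarrow> real" where
  "r x = inverse (x$3)"

lemma r_has_derivative: "x \<in> D \<Longrightarrow> (r has_derivative (\<lambda>a. - (r x)\<^sup>2 * a$3)) (at x)"
  unfolding r_def[abs_def] using x3_nonzero
  by (auto intro!: derivative_eq_intros nth_has_derivative simp: power2_eq_square)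

lemma metric_eq: "g x u v = \<beta>\<^sup>2 * (r x)\<^sup>2 * bH x u v"
  by (simp add: siklos_metric_def bH_def r_def divide_inverse power_inverse)

lemma metric_has_derivative':
  assumes "x \<in> D"
  shows "((\<lambda>y. g y u v) has_derivative
    (\<lambda>a. \<beta>\<^sup>2 * (r x)\<^sup>2 * (dH x a * (u$2 * v$2) - 2 * a$3 * r x * bH x u v))) (at x)"
  unfolding metric_eq
  by (auto intro!: derivative_eq_intros r_has_derivative[OF assms] bH_has_derivative[OF assms]
      simp: fun_eq_iff algebra_simps power2_eq_square)

lemma bilinear_bH: "bilinear (bH x)"
  unfolding bilinear_def bH_def by (auto intro!: linearI simp: algebra_simps)

sublocale pseudo_riemannian D g
proof
  show "open D" by (rule open_D)
next
  fix x assume x: "x \<in> D"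
  show "bilinear (g x)"
    unfolding bilinear_def metric_eq using bilinear_bH[of x, unfolded bilinear_def]
    by (simp add: linear_compose_scale_right[where 'b = real, simplified])
  show "(\<lambda>y. g y u v) differentiable (at x)" for u v
    using metric_has_derivative'[OF x] differentiableI by blast
  show "g x u v = g x v u" for u v
    by (simp add: metric_eq bH_def algebra_simps)
  show "nondegenerate (g x)"
    unfolding nondegenerate_def
  proof (intro allI impI, rule ccontr)
    fix u :: "real^4" assume "u \<noteq> 0" "\<nexists>v. g x u v \<noteq> 0"
    then have "bH x u v = 0" for v
      using x3_nonzero[OF x] \<beta>_nonzero by (auto simp: metric_eq r_def)
    from this[of "axis 1 1"] this[of "axis 2 1"] this[of "axis 3 1"] this[of "axis 4 1"]
    have "u = 0" by (simp add: bH_def axis_def vec_eq_iff forall_4)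
    with \<open>u \<noteq> 0\<close> show False by simp
  qed
qed

lemma dg_eq:
  "x \<in> D \<Longrightarrow> dg x a u v = \<beta>\<^sup>2 * (r x)\<^sup>2 * (dH x a * (u$2 * v$2) - 2 * a$3 * r x * bH x u v)"
  unfolding dg_def using frechet_derivative_eq[OF metric_has_derivative'] by simp

text \<open>Solution of the Koszul formula for \<open>bH\<close> after division by \<beta>^2 r^2. A
  vector c has w$1-coefficient c$2 and w$2-coefficient c$1 + H c$2 in \<open>bH x c w\<close>; so
  \<open>\<Gamma>2\<close> comes from testing with \<partial>_1, and \<open>\<Gamma>1\<close> from
  testing with \<partial>_2 and subtracting H times \<open>\<Gamma>2\<close>.\<close>

definition \<Gamma>1 :: "real^4 \<Rightarrow> real^4 \<Rightarrow> real^4 \<Rightarrow> real" where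
  "\<Gamma>1 x u v = (dH x u * v$2 + dH x v * u$2 - u$2 * v$2 * partial 2 H x) / 2
    - (u$3 * v$1 + v$3 * u$1) * r x"

definition \<Gamma>2 :: "real^4 \<Rightarrow> real^4 \<Rightarrow> real^4 \<Rightarrow> real" where
  "\<Gamma>2 x u v = - (u$3 * v$2 + v$3 * u$2) * r x"

definition \<Gamma>3 :: "real^4 \<Rightarrow> real^4 \<Rightarrow> real^4 \<Rightarrow> real" where
  "\<Gamma>3 x u v = - (2 * u$3 * v$3 - bH x u v) * r x - u$2 * v$2 * partial 3 H x / 2"

definition \<Gamma>4 :: "real^4 \<Rightarrow> real^4 \<Rightarrow> real^4 \<Rightarrow> real" where
  "\<Gamma>4 x u v = - (u$3 * v$4 + v$3 * u$4) * r x - u$2 * v$2 * partial 4 H x / 2"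

lemma christoffel_eq:
  assumes "x \<in> D"
  shows "christoffel g x u v = vec4 (\<Gamma>1 x u v) (\<Gamma>2 x u v) (\<Gamma>3 x u v) (\<Gamma>4 x u v)"
proof (rule christoffel_eqI[OF assms])
  fix w
  \<comment> \<open>Splitting off the common factor \<beta>^2 r^2 leaves a polynomial
    identity.\<close>
  have scale: "2 * B = X + Y - Z \<Longrightarrow> 2 * (c * B) = c * X + c * Y - c * Z" for B X Y Z c :: real
    by algebra
  have "2 * bH x (vec4 (\<Gamma>1 x u v) (\<Gamma>2 x u v) (\<Gamma>3 x u v) (\<Gamma>4 x u v)) w
    = (dH x u * (v$2 * w$2) - 2 * u$3 * r x * bH x v w) + (dH x v * (u$2 * w$2) - 2 * v$3 * r x * bH x u w)
      - (dH x w * (u$2 * v$2) - 2 * w$3 * r x * bH x u v)"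
    unfolding bH_def[of _ _ w] vec4_nth
    by (simp add: \<Gamma>1_def \<Gamma>2_def \<Gamma>3_def \<Gamma>4_def bH_def dH_def algebra_simps)
  then show "2 * g x (vec4 (\<Gamma>1 x u v) (\<Gamma>2 x u v) (\<Gamma>3 x u v) (\<Gamma>4 x u v)) w
      = dg x u v w + dg x v u w - dg x w u v"
    unfolding metric_eq dg_eq[OF assms] by (rule scale)
qed

definition d\<Gamma>1 :: "real^4 \<Rightarrow> real^4 \<Rightarrow> real^4 \<Rightarrow> real^4 \<Rightarrow> real" where
  "d\<Gamma>1 x a u v = ((ddH 2 x a * u$2 + ddH 3 x a * u$3 + ddH 4 x a * u$4) * v$2
      + (ddH 2 x a * v$2 + ddH 3 x a * v$3 + ddH 4 x a * v$4) * u$2 - u$2 * v$2 * ddH 2 x a) / 2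
    + (u$3 * v$1 + v$3 * u$1) * a$3 * (r x)\<^sup>2"

definition d\<Gamma>2 :: "real^4 \<Rightarrow> real^4 \<Rightarrow> real^4 \<Rightarrow> real^4 \<Rightarrow> real" where
  "d\<Gamma>2 x a u v = (u$3 * v$2 + v$3 * u$2) * a$3 * (r x)\<^sup>2"

definition d\<Gamma>3 :: "real^4 \<Rightarrow> real^4 \<Rightarrow> real^4 \<Rightarrow> real^4 \<Rightarrow> real" where
  "d\<Gamma>3 x a u v = (2 * u$3 * v$3 - bH x u v) * a$3 * (r x)\<^sup>2 + dH x a * u$2 * v$2 * r x
    - u$2 * v$2 * ddH 3 x a / 2"

definition d\<Gamma>4 :: "real^4 \<Rightarrow> real^4 \<Rightarrow> real^4 \<Rightarrow> real^4 \<Rightarrow> real" where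
  "d\<Gamma>4 x a u v = (u$3 * v$4 + v$3 * u$4) * a$3 * (r x)\<^sup>2 - u$2 * v$2 * ddH 4 x a / 2"

lemma christoffel_has_derivative:
  assumes "x \<in> D"
  shows "((\<lambda>y. christoffel g y u v) has_derivative
    (\<lambda>a. vec4 (d\<Gamma>1 x a u v) (d\<Gamma>2 x a u v) (d\<Gamma>3 x a u v) (d\<Gamma>4 x a u v))) (at x)"
proof -
  note rules = nth_has_derivative bH_has_derivative[OF assms] partial_H_has_derivative[OF assms]
    r_has_derivative[OF assms]
  have "((\<lambda>y. \<Gamma>1 y u v) has_derivative (\<lambda>a. d\<Gamma>1 x a u v)) (at x)"
    unfolding \<Gamma>1_def d\<Gamma>1_def dH_def
    by (auto intro!: derivative_eq_intros rules simp: fun_eq_iff algebra_simps)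
  moreover have "((\<lambda>y. \<Gamma>2 y u v) has_derivative (\<lambda>a. d\<Gamma>2 x a u v)) (at x)"
    unfolding \<Gamma>2_def d\<Gamma>2_def
    by (auto intro!: derivative_eq_intros rules simp: fun_eq_iff algebra_simps)
  moreover have "((\<lambda>y. \<Gamma>3 y u v) has_derivative (\<lambda>a. d\<Gamma>3 x a u v)) (at x)"
    unfolding \<Gamma>3_def d\<Gamma>3_def
    by (auto intro!: derivative_eq_intros rules simp: fun_eq_iff algebra_simps)
  moreover have "((\<lambda>y. \<Gamma>4 y u v) has_derivative (\<lambda>a. d\<Gamma>4 x a u v)) (at x)"
    unfolding \<Gamma>4_def d\<Gamma>4_def
    by (auto intro!: derivative_eq_intros rules simp: fun_eq_iff algebra_simps)
  ultimately have "((\<lambda>y. vec4 (\<Gamma>1 y u v) (\<Gamma>2 y u v) (\<Gamma>3 y u v) (\<Gamma>4 y u v)) has_derivative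
    (\<lambda>a. vec4 (d\<Gamma>1 x a u v) (d\<Gamma>2 x a u v) (d\<Gamma>3 x a u v) (d\<Gamma>4 x a u v))) (at x)"
    unfolding vec4_def by (intro has_derivative_add has_derivative_scaleR_left)
  then show ?thesis
    by (rule has_derivative_transform_within_open[OF _ open_D assms]) (simp add: christoffel_eq)
qed

text \<open>\<open>deviation x u v j\<close> is \<open>\<Sum>\<^sub>i A\<^sub>i\<^sub>j (u\<^sub>2 v\<^sub>i - v\<^sub>2 u\<^sub>i)\<close> with \<open>i\<close> in \<open>{3, 4}\<close>, for the matrix \<open>A\<close> described
  at the top.\<close>

definition deviation :: "real^4 \<Rightarrow> real^4 \<Rightarrow> real^4 \<Rightarrow> 4 \<Rightarrow> real" where
  "deviation x u v j =
     (partial 3 (partial j H) x - (if j = 3 then partial 3 H x * r x else 0)) * (u$2 * v$3 - v$2 * u$3)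
     + (partial 4 (partial j H) x - (if j = 4 then partial 3 H x * r x else 0)) * (u$2 * v$4 - v$2 * u$4)"

text \<open>Comparison of the four components as polynomials, once mixed derivatives of H are put
  into a fixed order. The \<open>vec4\<close> term is the deviation with its last index raised by
  the metric, which moves the component along dx2 to \<partial>_1 and leaves 0 along
  \<partial>_2.\<close>

lemma curvature_eq:
  assumes "x \<in> D"
  shows "curvature g x u v w = (- (1 / \<beta>\<^sup>2)) *\<^sub>R (g x v w *\<^sub>R u - g x u w *\<^sub>R v)
    + vec4 (- (deviation x u v 3 * w$3 + deviation x u v 4 * w$4) / 2) 0
        (w$2 * deviation x u v 3 / 2) (w$2 * deviation x u v 4 / 2)"
proof -
  have const: "(- (1 / \<beta>\<^sup>2)) *\<^sub>R (g x v w *\<^sub>R u - g x u w *\<^sub>R v)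
    = (- ((r x)\<^sup>2)) *\<^sub>R (bH x v w *\<^sub>R u - bH x u w *\<^sub>R v)"
    using \<beta>_nonzero by (simp add: metric_eq scaleR_diff_right)
  note comm = partial_commute[OF assms, of 3 2] partial_commute[OF assms, of 4 2] partial_commute[OF assms, of 4 3]
  note defs = \<Gamma>1_def \<Gamma>2_def \<Gamma>3_def \<Gamma>4_def d\<Gamma>1_def d\<Gamma>2_def d\<Gamma>3_def d\<Gamma>4_def
    bH_def dH_def ddH_def deviation_def comm
  have "(curvature g x u v w) $ i = ((- ((r x)\<^sup>2)) *\<^sub>R (bH x v w *\<^sub>R u - bH x u w *\<^sub>R v)
    + vec4 (- (deviation x u v 3 * w$3 + deviation x u v 4 * w$4) / 2) 0
        (w$2 * deviation x u v 3 / 2) (w$2 * deviation x u v 4 / 2)) $ i"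
    if "i \<in> {1, 2, 3, 4}" for i
    using that
    unfolding curvature_eq_christoffel christoffel_eq[OF assms]
      frechet_derivative_eq[OF christoffel_has_derivative[OF assms]]
    by (elim insertE emptyE; hypsubst; simp add: defs; simp add: field_simps; simp add: power2_eq_square algebra_simps)
  then show ?thesis
    unfolding const by (simp add: vec_eq_iff forall_4)
qed

section \<open>Normal vectors annihilated by the curvature\<close>

lemma r_nonzero: "x \<in> D \<Longrightarrow> r x \<noteq> 0"
  using x3_nonzero by (simp add: r_def)

lemma metric_eq_0_iff: "x \<in> D \<Longrightarrow> g x u v = 0 \<longleftrightarrow> bH x u v = 0"
  using r_nonzero \<beta>_nonzero by (simp add: metric_eq)

text \<open>The constant curvature part is a combination of u and v, hence orthogonal to n; only the
  deviation survives.\<close>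

lemma curvature_normal_eq_0_iff:
  assumes "x \<in> D" "g x u n = 0" "g x v n = 0"
  shows "g x (curvature g x u v w) n = 0 \<longleftrightarrow>
    deviation x u v 3 * (w$2 * n$3 - w$3 * n$2) + deviation x u v 4 * (w$2 * n$4 - w$4 * n$2) = 0"
proof -
  note b = bilinear_metric[OF assms(1)]
  have E: "g x (vec4 (- (deviation x u v 3 * w$3 + deviation x u v 4 * w$4) / 2) 0
        (w$2 * deviation x u v 3 / 2) (w$2 * deviation x u v 4 / 2)) n = \<beta>\<^sup>2 * (r x)\<^sup>2 / 2 *
    (deviation x u v 3 * (w$2 * n$3 - w$3 * n$2) + deviation x u v 4 * (w$2 * n$4 - w$4 * n$2))"
    unfolding metric_eq bH_def vec4_nth by (simp add: field_simps)
  show ?thesis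
    unfolding curvature_eq[OF assms(1)] bilinear_ladd[OF b] bilinear_lmul[OF b] bilinear_lsub[OF b] assms(2,3) E
    using r_nonzero[OF assms(1)] \<beta>_nonzero by simp
qed

text \<open>Flatness refers to the matrix A: the deviation vanishes at x, while the curvature there
  is of the constant type -1/\<beta>^2.\<close>

definition flat_at :: "real^4 \<Rightarrow> bool" where
  "flat_at x \<longleftrightarrow> partial 3 (partial 3 H) x = partial 3 H x * r x
    \<and> partial 4 (partial 4 H) x = partial 3 H x * r x \<and> partial 4 (partial 3 H) x = 0"

text \<open>Since n is not orthogonal to \<partial>_1, components 2, 3, 4 of a vector orthogonal to
  n can be prescribed; \<open>lift\<close> solves for the first one.\<close>

lemma flat_at_if_normal_not_orthogonal:
  assumes "x \<in> D" "n$2 \<noteq> 0"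
    and flat: "\<And>u v w. g x u n = 0 \<Longrightarrow> g x v n = 0 \<Longrightarrow> g x w n = 0 \<Longrightarrow> g x (curvature g x u v w) n = 0"
  shows "flat_at x"
proof -
  define lift where "lift b c d = vec4 (- (b * n$1 + H x * (b * n$2) + c * n$3 + d * n$4) / n$2) b c d" for b c d
  have lift: "g x (lift b c d) n = 0" for b c d
    using assms(2) by (simp add: metric_eq_0_iff[OF assms(1)] lift_def bH_def)
  have lift_nth: "lift b c d $ 2 = b" "lift b c d $ 3 = c" "lift b c d $ 4 = d" for b c d
    by (simp_all add: lift_def)
  have main: "deviation x (lift 1 0 0) (lift 0 c d) 3 * (w$2 * n$3 - w$3 * n$2)
      + deviation x (lift 1 0 0) (lift 0 c d) 4 * (w$2 * n$4 - w$4 * n$2) = 0" if "g x w n = 0" for c d w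
    using flat[OF lift lift that, of 1 0 0 0 c d]
    unfolding curvature_normal_eq_0_iff[OF assms(1) lift lift] .
  show ?thesis
    \<comment> \<open>Every w used here has w$2 = 0. Letting (c, d) and the (3,4)-part of w run
      through the two unit vectors, the equations read -n$2 A_ij = 0 for all four entries.\<close>
    using main[OF lift, of 1 0 0 1 0] main[OF lift, of 1 0 0 0 1] main[OF lift, of 0 1 0 1 0]
      main[OF lift, of 0 1 0 0 1] assms(2) partial_commute[OF assms(1), of 3 4]
    by (simp add: flat_at_def deviation_def lift_nth)
qed

text \<open>\<open>Y\<close> is the (3,4)-part of n turned by a right angle, and \<open>X\<close> is
  orthogonal to n with second component 1. For u = w = \<open>X\<close> and v = \<open>Y\<close> the
  curvature condition becomes A(Y, n) = 0, where the multiple of the identity in A drops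
  out.\<close>

lemma principal_direction:
  assumes "x \<in> D" "n$2 = 0" "g x n n \<noteq> 0"
    and flat: "\<And>u v w. g x u n = 0 \<Longrightarrow> g x v n = 0 \<Longrightarrow> g x w n = 0 \<Longrightarrow> g x (curvature g x u v w) n = 0"
  shows "(partial 3 (partial 3 H) x - partial 4 (partial 4 H) x) * (n$3 * n$4)
    = partial 3 (partial 4 H) x * ((n$3)\<^sup>2 - (n$4)\<^sup>2)"
proof -
  define N where "N = (n$3)\<^sup>2 + (n$4)\<^sup>2"
  have "N \<noteq> 0" using assms(1-3) by (simp add: metric_eq_0_iff bH_def N_def power2_eq_square)
  \<comment> \<open>With n$2 = 0, orthogonality to n reads n$1 + X$3 n$3 + X$4 n$4 = 0; the solution
    proportional to (n$3, n$4) is taken.\<close>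
  define X where "X = vec4 0 1 (- n$1 * n$3 / N) (- n$1 * n$4 / N)"
  define Y where "Y = vec4 0 0 (- n$4) (n$3)"
  have "n$1 + - n$1 * n$3 / N * n$3 + - n$1 * n$4 / N * n$4 = 0"
    using \<open>N \<noteq> 0\<close> by (simp add: field_simps) (simp add: N_def power2_eq_square algebra_simps)
  then have X: "g x X n = 0"
    using assms(2) by (simp add: metric_eq_0_iff[OF assms(1)] X_def bH_def)
  have Y: "g x Y n = 0"
    using assms(2) by (simp add: metric_eq_0_iff[OF assms(1)] Y_def bH_def)
  show ?thesis
    using flat[OF X Y X] assms(2)
    unfolding curvature_normal_eq_0_iff[OF assms(1) X Y]
    by (simp add: X_def Y_def deviation_def partial_commute[OF assms(1), of 4 3] algebra_simps power2_eq_square)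
qed

lemma flat_imp_constant_curvature:
  assumes "W \<subseteq> D" "\<And>x. x \<in> W \<Longrightarrow> flat_at x"
  shows "constant_curvature_on W g"
  unfolding constant_curvature_on_def
proof (intro exI ballI allI)
  fix x u v w assume "x \<in> W"
  then have "x \<in> D" "flat_at x" using assms by auto
  then have "deviation x u v 3 = 0" "deviation x u v 4 = 0"
    using partial_commute[OF \<open>x \<in> D\<close>, of 3 4] by (auto simp: deviation_def flat_at_def)
  then show "curvature g x u v w = (- (1 / \<beta>\<^sup>2)) *\<^sub>R (g x v w *\<^sub>R u - g x u w *\<^sub>R v)"
    by (simp add: curvature_eq[OF \<open>x \<in> D\<close>] vec4_def)
qed

text \<open>Carries flatness, known only on the hypersurface, along the lines in direction
  \<partial>_1 to other points of D.\<close>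

lemma flat_at_x1_independent:
  assumes "x \<in> D" "y \<in> D" "x$2 = y$2" "x$3 = y$3" "x$4 = y$4" "flat_at x"
  shows "flat_at y"
proof -
  have ind: "x1_independent (partial i H)" "x1_independent (partial i (partial j H))" for i j
    by (intro x1_independent_partial smooth_partial x1_independent_H smooth_H)+
  show ?thesis
    using assms(4,6) x1_independentD[OF ind(1) assms(1-5)] x1_independentD[OF ind(2) assms(1-5)]
    by (simp add: flat_at_def r_def)
qed

lemma lorentzian_if_normal_orthogonal:
  fixes L :: "real^3 \<Rightarrow> real^4"
  assumes "x \<in> D" "n$2 = 0" "g x n n \<noteq> 0" "range L = {w. g x n w = 0}"
  shows "lorentzian (\<lambda>u v. g x (L u) (L v))"
proof -
  define N where "N = (n$3)\<^sup>2 + (n$4)\<^sup>2"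
  have "N > 0" using assms(1-3)
    by (auto simp: metric_eq_0_iff bH_def N_def power2_eq_square sum_squares_gt_zero_iff)
  define k where "k = 1 / sqrt (\<beta>\<^sup>2 * (r x)\<^sup>2)"
  have k: "\<beta>\<^sup>2 * (r x)\<^sup>2 * (k * k) = 1"
    using r_nonzero[OF assms(1)] \<beta>_nonzero by (simp add: k_def)
  \<comment> \<open>The last two coordinates make \<open>X\<close> orthogonal to n, and the first is
    then determined by \<open>bH x X X = 0\<close>.\<close>
  define X where "X = vec4 (- (H x + (n$1)\<^sup>2 / N) / 2) 1 (- n$1 * n$3 / N) (- n$1 * n$4 / N)"
  define Y where "Y = vec4 0 0 (- n$4) (n$3)"
  define E where "E = vec4 1 0 0 0"
  have n0: "n$1 + - n$1 * n$3 / N * n$3 + - n$1 * n$4 / N * n$4 = 0"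
    using \<open>N > 0\<close> by (simp add: field_simps) (simp add: N_def power2_eq_square algebra_simps)
  \<comment> \<open>\<open>E\<close> and \<open>X\<close> are null vectors with product 1 for \<open>bH\<close>, so \<open>E - X\<close> is timelike and \<open>E + X\<close> spacelike.\<close>
  have XX: "bH x X X = 0"
  proof -
    have "(n$1 * n$3 / N) * (n$1 * n$3 / N) + (n$1 * n$4 / N) * (n$1 * n$4 / N) = (n$1)\<^sup>2 * N / N\<^sup>2"
      by (simp add: N_def power2_eq_square algebra_simps add_divide_distrib)
    also have "\<dots> = (n$1)\<^sup>2 / N" using \<open>N > 0\<close> by (simp add: power2_eq_square)
    finally show ?thesis by (simp add: bH_def X_def)
  qed
  have YY: "bH x Y Y = N" and EE: "bH x E E = 0" and EX: "bH x E X = 1" "bH x X E = 1"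
    and EY: "bH x E Y = 0" "bH x Y E = 0" and XY: "bH x X Y = 0" "bH x Y X = 0"
    by (simp_all add: bH_def X_def Y_def E_def N_def power2_eq_square)
  have orth: "g x n E = 0" "g x n X = 0" "g x n Y = 0"
    using n0 assms(2) by (simp_all add: metric_eq_0_iff[OF assms(1)] bH_def X_def Y_def E_def algebra_simps)
  define w :: "3 \<Rightarrow> real^4" where
    "w i = (if i = 1 then (k / sqrt 2) *\<^sub>R (E - X) else if i = 2 then (k / sqrt 2) *\<^sub>R (E + X)
      else (k / sqrt N) *\<^sub>R Y)" for i
  note b = bilinear_metric[OF assms(1)]
  have "g x n (w i) = 0" for i
    by (simp add: w_def bilinear_radd[OF b] bilinear_rsub[OF b] bilinear_rmul[OF b] orth)
  then have "\<forall>i. \<exists>u. L u = w i"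
    using assms(4) by (metis (mono_tags, lifting) mem_Collect_eq rangeE)
  then obtain e where e: "\<And>i. L (e i) = w i" by metis
  note bb = bilinear_bH[of x]
  have "g x (w i) (w j) = (if i = j then if i = 1 then - 1 else 1 else 0)" for i j
    using exhaust_3[of i] exhaust_3[of j] k \<open>N > 0\<close>
    by (elim disjE; hypsubst)
      (simp_all add: metric_eq w_def bilinear_radd[OF bb] bilinear_rsub[OF bb] bilinear_rmul[OF bb]
        bilinear_ladd[OF bb] bilinear_lsub[OF bb] bilinear_lmul[OF bb] XX YY EE EX EY XY)
  then show ?thesis
    unfolding lorentzian_def e[symmetric] by blast
qed

end

section \<open>Hypersurfaces of Siklos spacetimes\<close>

text \<open>Meant for the induced metric on a chart: the first two terms of the Koszul expression
  change places, whatever the matrix in front of it.\<close>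

lemma christoffel_commute_if_symmetric:
  assumes "\<And>y u v. g y u v = g y v u"
  shows "christoffel g x u v = christoffel g x v u"
proof -
  have "(\<lambda>y. g y u v) = (\<lambda>y. g y v u)" using assms by auto
  then show ?thesis
    unfolding christoffel_def by (simp add: add.commute)
qed

section \<open>Charts and local angles\<close>

lemma smooth_atlas_chart:
  assumes "smooth_atlas A" "(U, \<phi>) \<in> A"
  shows "open U" "open (\<phi> ` U)" "homeomorphism U (\<phi> ` U) \<phi> (inv_into U \<phi>)"
proof -
  have "\<forall>(U, \<phi>)\<in>A. open U \<and> open (\<phi> ` U) \<and> homeomorphism U (\<phi> ` U) \<phi> (inv_into U \<phi>)"
    using assms(1) unfolding smooth_atlas_def by (elim conjE)
  from bspec[OF this assms(2)]
  show "open U" "open (\<phi> ` U)" "homeomorphism U (\<phi> ` U) \<phi> (inv_into U \<phi>)" by simp_all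
qed

lemma smooth_atlas_cover:
  assumes "smooth_atlas A"
  obtains U \<phi> where "(U, \<phi>) \<in> A" "p \<in> U"
proof -
  have "(\<Union>(U, \<phi>)\<in>A. U) = UNIV"
    using assms unfolding smooth_atlas_def by (elim conjE)
  then show ?thesis using that by (auto simp: set_eq_iff)
qed

lemma chart_inv_into:
  assumes "smooth_atlas A" "(U, \<phi>) \<in> A" "p \<in> U"
  shows "inv_into U \<phi> (\<phi> p) = p"
  using homeomorphism_apply1[OF smooth_atlas_chart(3)[OF assms(1,2)] assms(3)] .

lemma smooth_map_on_chart:
  "smooth_map_on A S f \<Longrightarrow> (U, \<phi>) \<in> A \<Longrightarrow> smooth_on (\<phi> ` (U \<inter> S)) (f \<circ> inv_into U \<phi>)"
  unfolding smooth_map_on_def by blast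

lemma open_chart_image:
  assumes "smooth_atlas A" "(U, \<phi>) \<in> A" "open V"
  shows "open (\<phi> ` (U \<inter> V))"
proof -
  note chart = smooth_atlas_chart[OF assms(1,2)]
  have "openin (top_of_set (\<phi> ` U)) (\<phi> ` (U \<inter> V))"
    by (rule homeomorphism_imp_open_map[OF chart(3)]) (use assms(3) in \<open>auto simp: openin_open\<close>)
  then show ?thesis using chart(2) openin_open_eq by blast
qed

lemma smooth_map_on_continuous:
  fixes f :: "'p::topological_space \<Rightarrow> 'b::real_normed_vector" and A :: "('p, 'm::finite) chart set"
  assumes "smooth_atlas A" "smooth_map_on A UNIV f"
  shows "continuous_on UNIV f"
proof -
  have "continuous_on U f" if "(U, \<phi>) \<in> A" for U \<phi>
  proof -
    note chart = smooth_atlas_chart[OF assms(1) that]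
    have "continuous_on (\<phi> ` U) (f \<circ> inv_into U \<phi>)"
      using smooth_on_continuous[OF smooth_map_on_chart[OF assms(2) that]] by simp
    with homeomorphism_cont1[OF chart(3)] have "continuous_on U ((f \<circ> inv_into U \<phi>) \<circ> \<phi>)"
      by (rule continuous_on_compose)
    then show ?thesis
      by (rule continuous_on_eq) (simp add: chart_inv_into[OF assms(1) that])
  qed
  then have "continuous_on (\<Union>(fst ` A)) f"
    using smooth_atlas_chart(1)[OF assms(1)] by (intro continuous_on_open_Union) auto
  moreover have "\<Union>(fst ` A) = UNIV"
    using assms(1) unfolding smooth_atlas_def by (simp add: case_prod_beta')
  ultimately show ?thesis by simp
qed

text \<open>The denominator and numerator are the cosine and sine of the angle from (cos t, sin t)
  to (c, s). A positive cosine puts a representative of that angle between -\<pi>/2 and \<pi>/2,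
  where arctan recovers it from the tangent.\<close>

lemma cos_sin_add_arctan:
  assumes "c\<^sup>2 + s\<^sup>2 = 1" "cos t * c + sin t * s > 0"
  shows "cos (t + arctan ((cos t * s - sin t * c) / (cos t * c + sin t * s))) = c"
    and "sin (t + arctan ((cos t * s - sin t * c) / (cos t * c + sin t * s))) = s"
proof -
  define P where "P = cos t * c + sin t * s"
  define Q where "Q = cos t * s - sin t * c"
  have t: "cos t * cos t + sin t * sin t = 1"
    using sin_cos_squared_add3[of t] .
  have "P > 0" using assms(2) by (simp add: P_def)
  have "P\<^sup>2 + Q\<^sup>2 = (cos t * cos t + sin t * sin t) * (c\<^sup>2 + s\<^sup>2)"
    unfolding P_def Q_def by algebra
  then have "1 + (Q / P)\<^sup>2 = (1 / P)\<^sup>2"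
    using \<open>P > 0\<close> t assms(1) by (simp add: field_simps)
  then have "sqrt (1 + (Q / P)\<^sup>2) = 1 / P"
    using \<open>P > 0\<close> by simp
  then have "cos (arctan (Q / P)) = P" "sin (arctan (Q / P)) = Q"
    using \<open>P > 0\<close> by (simp_all add: cos_arctan sin_arctan)
  moreover have eq: "cos t * P - sin t * Q = (cos t * cos t + sin t * sin t) * c"
    "sin t * P + cos t * Q = (cos t * cos t + sin t * sin t) * s"
    unfolding P_def Q_def by algebra+
  ultimately show "cos (t + arctan (Q / P)) = c" "sin (t + arctan (Q / P)) = s"
    by (simp_all add: cos_add sin_add eq[unfolded t mult_1])
qed

section \<open>Hypersurfaces with Codazzi second fundamental form\<close>

locale siklos_hypersurface = siklos D H \<Lambda> \<beta>
  for D :: "(real^4) set" and H :: "real^4 \<Rightarrow> real" and \<Lambda> \<beta> :: real +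
  fixes A :: "('p::topological_space, 3) chart set" and F \<xi> :: "'p \<Rightarrow> real^4"
    and \<epsilon> :: real and h :: "'p \<Rightarrow> real^4 \<Rightarrow> real^4 \<Rightarrow> real"
  assumes hypersurface: "hypersurface D g A F"
    and \<epsilon>: "\<epsilon> \<in> {-1, 1}"
    and unit_normal: "unit_normal g A F \<epsilon> \<xi>"
    and second_fundamental_form: "second_fundamental_form g A F \<xi> h"
    and codazzi: "codazzi g A F h"
begin

lemma atlas: "smooth_atlas A" and F_in_D: "F p \<in> D" and smooth_F: "smooth_map_on A UNIV F"
  using hypersurface unfolding hypersurface_def by auto

lemma smooth_\<xi>: "smooth_map_on A UNIV \<xi>" and metric_\<xi>: "g (F p) (\<xi> p) (\<xi> p) = \<epsilon>"
  using unit_normal unfolding unit_normal_def by auto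

lemma \<xi>_nonzero: "\<xi> p \<noteq> 0"
  using metric_\<xi>[of p] \<epsilon> bilinear_lzero[OF bilinear_metric[OF F_in_D]] by fastforce

context
  fixes U :: "'p set" and \<phi> :: "'p \<Rightarrow> real^3"
  assumes chart: "(U, \<phi>) \<in> A"
begin

abbreviation f :: "real^3 \<Rightarrow> real^4" where "f \<equiv> F \<circ> inv_into U \<phi>"

abbreviation n :: "real^3 \<Rightarrow> real^4" where "n \<equiv> \<xi> \<circ> inv_into U \<phi>"

lemma smooth_f: "smooth_on (\<phi> ` U) f" and smooth_n: "smooth_on (\<phi> ` U) n"
  using smooth_map_on_chart[OF smooth_F chart] smooth_map_on_chart[OF smooth_\<xi> chart] by simp_all

lemma f_has_derivative: "x \<in> \<phi> ` U \<Longrightarrow> (f has_derivative frechet_derivative f (at x)) (at x)"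
  by (rule smooth_on_has_derivative[OF smooth_f])

lemma inj_f': "x \<in> \<phi> ` U \<Longrightarrow> inj (frechet_derivative f (at x))"
  using hypersurface chart unfolding hypersurface_def by fast

lemma normal_f': "x \<in> \<phi> ` U \<Longrightarrow> g (f x) (n x) (frechet_derivative f (at x) u) = 0"
  using unit_normal chart unfolding unit_normal_def by fastforce

lemma range_f':
  assumes "x \<in> \<phi> ` U"
  shows "range (frechet_derivative f (at x)) = {w. g (f x) (n x) w = 0}"
  by (rule normal_complement_eq_range)
    (use assms F_in_D \<xi>_nonzero inj_f' normal_f' has_derivative_linear[OF f_has_derivative] in auto)

lemma curvature_normal_chart:
  assumes "x \<in> \<phi> ` U"
  shows "g (f x) (curvature g (f x) (frechet_derivative f (at x) u) (frechet_derivative f (at x) v)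
        (frechet_derivative f (at x) w)) (n x) = 0"
proof -
  let ?G = "\<lambda>x u v. levi_civita (pullback g f) (\<lambda>_. u) (\<lambda>_. v) x"
  let ?h = "tensor_in_chart F h U \<phi>"
  have eq: "(frechet_derivative (\<lambda>y. ?h y v w) (at x) u - ?h x (?G x u v) w - ?h x v (?G x u w))
      - (frechet_derivative (\<lambda>y. ?h y u w) (at x) v - ?h x (?G x v u) w - ?h x u (?G x v w))
    = \<epsilon> * g (f x) (curvature g (f x) (frechet_derivative f (at x) u) (frechet_derivative f (at x) v)
        (frechet_derivative f (at x) w)) (n x)"
  proof (rule codazzi_equation[OF smooth_atlas_chart(2)[OF atlas chart] assms smooth_f])
    show "f ` \<phi> ` U \<subseteq> D" using F_in_D by auto
    show "(\<lambda>y. christoffel g y u v) differentiable (at (f x))" for u v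
      using christoffel_has_derivative F_in_D unfolding differentiable_def comp_def by blast
    show "smooth_on (\<phi> ` U) n" by (rule smooth_n)
    show "g (f y) (n y) (n y) = \<epsilon>" for y by (simp add: metric_\<xi>)
    show "\<epsilon>\<^sup>2 = 1" using \<epsilon> by auto
    show "g (f y) (n y) (frechet_derivative f (at y) u) = 0" if "y \<in> \<phi> ` U" for y u
      by (rule normal_f'[OF that])
    show "levi_civita_along g f (\<lambda>_. u) (\<lambda>y. frechet_derivative f (at y) v) y =
      frechet_derivative f (at y) (?G y u v) + ?h y u v *\<^sub>R n y" if "y \<in> \<phi> ` U" for y u v
      using second_fundamental_form that chart smooth_on_const[of "\<phi> ` U"]
      unfolding second_fundamental_form_def Let_def comp_def[of \<xi>] by fast
    have "pullback g f y u v = pullback g f y v u" for y u v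
      by (simp add: pullback_def siklos_metric_def algebra_simps)
    then show "?G x u v = ?G x v u" for u v
      unfolding levi_civita_const by (rule christoffel_commute_if_symmetric)
  qed
  \<comment> \<open>The Codazzi symmetry for constant fields makes the left side of
    \<open>eq\<close> vanish, and \<epsilon> is nonzero.\<close>
  have "covariant_derivative_2tensor (pullback g f) ?h (\<lambda>_. u) (\<lambda>_. v) (\<lambda>_. w) x
    = covariant_derivative_2tensor (pullback g f) ?h (\<lambda>_. v) (\<lambda>_. u) (\<lambda>_. w) x"
    using codazzi chart assms smooth_on_const[of "\<phi> ` U"] unfolding codazzi_def Let_def by fast
  then show ?thesis
    using eq \<epsilon> unfolding covariant_derivative_2tensor_def by auto
qed

end

text \<open>Chart-free form: by \<open>range_f'\<close>, the vectors orthogonal to \<xi> are exactly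
  the images of vectors in the chart.\<close>

lemma curvature_normal:
  assumes "g (F p) u (\<xi> p) = 0" "g (F p) v (\<xi> p) = 0" "g (F p) w (\<xi> p) = 0"
  shows "g (F p) (curvature g (F p) u v w) (\<xi> p) = 0"
proof -
  obtain U \<phi> where chart: "(U, \<phi>) \<in> A" and p: "p \<in> U"
    by (rule smooth_atlas_cover[OF atlas])
  have \<phi>p: "\<phi> p \<in> \<phi> ` U" using p by auto
  note inv = chart_inv_into[OF atlas chart p]
  have "y \<in> range (frechet_derivative (F \<circ> inv_into U \<phi>) (at (\<phi> p)))" if "g (F p) y (\<xi> p) = 0" for y
    using that metric_commute[OF F_in_D, of p y "\<xi> p"]
    unfolding range_f'[OF chart \<phi>p] by (simp add: inv)
  from this[OF assms(1)] this[OF assms(2)] this[OF assms(3)] show ?thesis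
    using curvature_normal_chart[OF chart \<phi>p] by (auto simp: inv)
qed

text \<open>Flatness is obtained only at points of M, but the hypothesis needs an open set of D.
  Where \<xi>$2 is nonzero, M is transversal to \<partial>_1, so its image under the projection
  \<pi> that forgets x1 contains an open set, and flatness spreads over the points of D above
  it.\<close>

lemma \<xi>_2_eq_0:
  assumes not_constant_curvature:
    "\<And>p W. \<lbrakk>open W; W \<subseteq> D; F p \<in> W\<rbrakk> \<Longrightarrow> \<not> constant_curvature_on W g"
  shows "\<xi> p $ 2 = 0"
proof (rule ccontr)
  assume ne: "\<xi> p $ 2 \<noteq> 0"
  obtain U \<phi> where chart: "(U, \<phi>) \<in> A" and p: "p \<in> U"
    by (rule smooth_atlas_cover[OF atlas])
  note inv = chart_inv_into[OF atlas chart p]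
  let ?f = "F \<circ> inv_into U \<phi>" and ?n = "\<xi> \<circ> inv_into U \<phi>" and ?x = "\<phi> p"
  let ?f' = "frechet_derivative ?f (at ?x)"
  have x: "?x \<in> \<phi> ` U" using p by auto
  define S where "S = {y \<in> \<phi> ` U. ?n y $ 2 \<noteq> 0}"
  have "continuous_on (\<phi> ` U) (\<lambda>y. ?n y $ 2)"
    by (intro continuous_intros smooth_on_continuous smooth_n chart)
  then have "open S"
    unfolding S_def using smooth_atlas_chart(2)[OF atlas chart]
    by (auto simp: continuous_on_open_vimage vimage_def Int_def conj_commute dest!: spec[of _ "- {0}"])
  have "?x \<in> S" using x ne by (simp add: S_def inv)
  define \<pi> :: "real^4 \<Rightarrow> real^3" where
    "\<pi> v = (\<chi> i. if i = 1 then v$2 else if i = 2 then v$3 else v$4)" for v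
  have \<pi>_eq_iff: "\<pi> v = \<pi> w \<longleftrightarrow> v$2 = w$2 \<and> v$3 = w$3 \<and> v$4 = w$4" for v w
    by (simp add: \<pi>_def vec_eq_iff forall_3)
  have "linear \<pi>"
    by (rule linearI) (simp_all add: \<pi>_def vec_eq_iff)
  then have "bounded_linear \<pi>" by (simp add: linear_conv_bounded_linear)
  have lin: "linear ?f'"
    using has_derivative_linear[OF f_has_derivative[OF chart x]] .
  have "linear (\<pi> \<circ> ?f')" by (rule linear_compose[OF lin \<open>linear \<pi>\<close>])
  moreover have "inj (\<pi> \<circ> ?f')"
    \<comment> \<open>A tangent vector killed by \<pi> is a multiple of \<partial>_1; it is
      orthogonal to \<xi> while \<partial>_1 is not, so it is zero.\<close>
    unfolding linear_injective_0[OF \<open>linear (\<pi> \<circ> ?f')\<close>]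
  proof (intro allI impI)
    fix u assume "(\<pi> \<circ> ?f') u = 0"
    then have "?f' u $ 2 = 0" "?f' u $ 3 = 0" "?f' u $ 4 = 0"
      using \<pi>_eq_iff[of "?f' u" 0] linear_0[OF \<open>linear \<pi>\<close>] by auto
    moreover from this have "?f' u $ 1 = 0"
      using normal_f'[OF chart x, of u] ne F_in_D[of p]
      by (simp add: inv metric_eq_0_iff bH_def)
    ultimately have "?f' u = 0" by (simp add: vec_eq_iff forall_4)
    then show "u = 0"
      using inj_f'[OF chart x] linear_injective_0[OF lin] by blast
  qed
  ultimately obtain g' where "linear g'" "(\<pi> \<circ> ?f') \<circ> g' = id"
    using linear_surjective_right_inverse linear_injective_imp_surjective by blast
  \<comment> \<open>An interior point of the image is all that is required, and for this
    invertibility of the derivative at the single point ?x is enough.\<close>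
  have "(\<pi> \<circ> ?f) ?x \<in> interior ((\<pi> \<circ> ?f) ` S)"
  proof (rule sussmann_open_mapping)
    have "continuous_on S ?f"
      by (rule continuous_on_subset[OF smooth_on_continuous[OF smooth_f[OF chart]]]) (auto simp: S_def)
    then show "continuous_on S (\<pi> \<circ> ?f)"
      by (rule continuous_on_compose) (rule linear_continuous_on[OF \<open>bounded_linear \<pi>\<close>])
    show "((\<pi> \<circ> ?f) has_derivative (\<pi> \<circ> ?f')) (at ?x)"
      using bounded_linear.has_derivative[OF \<open>bounded_linear \<pi>\<close> f_has_derivative[OF chart x]]
      by (simp add: comp_def)
    show "bounded_linear g'" using \<open>linear g'\<close> by (simp add: linear_conv_bounded_linear)
    show "?x \<in> interior S" using \<open>open S\<close> \<open>?x \<in> S\<close> by (simp add: interior_open)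
  qed (use \<open>open S\<close> \<open>?x \<in> S\<close> \<open>(\<pi> \<circ> ?f') \<circ> g' = id\<close> in auto)
  \<comment> \<open>All points of D above the interior of the projected piece of M, whatever their
    first coordinate.\<close>
  define W where "W = D \<inter> \<pi> -` interior ((\<pi> \<circ> ?f) ` S)"
  have "open W"
    unfolding W_def
    by (intro open_Int open_D open_vimage open_interior linear_continuous_on \<open>bounded_linear \<pi>\<close>)
  have "flat_at y" if "y \<in> W" for y
  proof -
    have "y \<in> D" and "\<pi> y \<in> (\<pi> \<circ> ?f) ` S"
      using that interior_subset by (auto simp: W_def)
    then obtain q where q: "\<pi> (F q) = \<pi> y" "\<xi> q $ 2 \<noteq> 0"
      by (auto simp: S_def)
    have "flat_at (F q)"
      using flat_at_if_normal_not_orthogonal[OF F_in_D q(2)] curvature_normal by blast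
    then show "flat_at y"
      using flat_at_x1_independent[OF F_in_D \<open>y \<in> D\<close>] q(1) \<pi>_eq_iff by blast
  qed
  moreover have "F p \<in> W"
    using \<open>(\<pi> \<circ> ?f) ?x \<in> interior ((\<pi> \<circ> ?f) ` S)\<close> F_in_D by (simp add: W_def inv)
  ultimately show False
    using not_constant_curvature[OF \<open>open W\<close> _ \<open>F p \<in> W\<close>] flat_imp_constant_curvature[of W]
    by (auto simp: W_def)
qed

lemma \<epsilon>_eq_1:
  assumes "\<xi> p $ 2 = 0"
  shows "\<epsilon> = 1"
proof -
  have "\<epsilon> \<ge> 0"
    using metric_\<xi>[of p] assms by (simp add: metric_eq bH_def flip: metric_\<xi>[of p])
  then show ?thesis using \<epsilon> by auto
qed

lemma timelike:
  assumes "\<And>p. \<xi> p $ 2 = 0"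
  shows "timelike_hypersurface g A F"
  unfolding timelike_hypersurface_def
proof (intro ballI, clarify)
  fix U \<phi> p assume chart: "(U, \<phi>) \<in> A" and p: "p \<in> U"
  have x: "\<phi> p \<in> \<phi> ` U" using p by auto
  show "lorentzian (pullback g (F \<circ> inv_into U \<phi>) (\<phi> p))"
    unfolding pullback_def
    by (rule lorentzian_if_normal_orthogonal[OF _ _ _ range_f'[OF chart x]])
      (use F_in_D metric_\<xi> \<epsilon> assms in auto)
qed

lemma normal_form:
  assumes \<xi>2: "\<And>p. \<xi> p $ 2 = 0"
  shows "\<exists>U (a :: 'p \<Rightarrow> real) (\<theta> :: 'p \<Rightarrow> real).
    open U \<and> p \<in> U \<and> smooth_map_on A U a \<and> smooth_map_on A U \<theta> \<and>
    (\<forall>q\<in>U.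
       \<xi> q = a q *\<^sub>R axis 1 1
            + (F q $ 3 / \<beta> * cos (\<theta> q)) *\<^sub>R axis 3 1
            + (F q $ 3 / \<beta> * sin (\<theta> q)) *\<^sub>R axis 4 1 \<and>
       (partial 3 (partial 3 H) (F q) - partial 4 (partial 4 H) (F q)) * sin (2 * \<theta> q)
         = 2 * partial 3 (partial 4 H) (F q) * cos (2 * \<theta> q))"
proof -
  \<comment> \<open>The cosine and sine demanded by the normal form; they lie on the unit circle
    because \<xi>$2 = 0 and \<epsilon> = 1.\<close>
  define c where "c q = \<beta> * \<xi> q $ 3 / F q $ 3" for q
  define s where "s q = \<beta> * \<xi> q $ 4 / F q $ 3" for q
  have F3: "F q $ 3 \<noteq> 0" for q using x3_nonzero[OF F_in_D] .
  have cs: "(c q)\<^sup>2 + (s q)\<^sup>2 = 1" for q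
    using metric_\<xi>[of q] \<epsilon>_eq_1[OF \<xi>2]
    by (simp add: siklos_metric_def \<xi>2 c_def s_def power2_eq_square add_divide_distrib distrib_left mult_ac)
  obtain t where t: "c p = cos t" "s p = sin t"
    using sincos_total_2pi_le[OF cs[of p]] by blast
  \<comment> \<open>The cosine of the angle between (c, s) at q and at p. On the open set where it
    is positive, t plus an arctan is a smooth branch of the angle.\<close>
  define P where "P q = cos t * c q + sin t * s q" for q
  define \<theta> where "\<theta> q = t + arctan ((cos t * s q - sin t * c q) / P q)" for q
  define U where "U = {q. 0 < P q}"
  have \<theta>: "cos (\<theta> q) = c q" "sin (\<theta> q) = s q" if "q \<in> U" for q
    using cos_sin_add_arctan[OF cs[of q], of t] that by (simp_all add: \<theta>_def P_def U_def)
  have "open U"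
    unfolding U_def P_def c_def s_def
    by (intro open_Collect_less continuous_intros smooth_map_on_continuous[OF atlas] smooth_F smooth_\<xi>)
      (simp_all add: F3)
  have "P p = 1"
    using cs[of p] by (simp add: P_def t power2_eq_square)
  then have "p \<in> U" by (simp add: U_def)
  have smooth: "smooth_on (\<psi> ` (V \<inter> U)) (\<lambda>x. \<xi> (inv_into V \<psi> x) $ 1)"
    "smooth_on (\<psi> ` (V \<inter> U)) (\<lambda>x. \<theta> (inv_into V \<psi> x))" if chart: "(V, \<psi>) \<in> A" for V \<psi>
  proof -
    let ?T = "\<psi> ` (V \<inter> U)"
    note T = open_chart_image[OF atlas chart \<open>open U\<close>]
    have comp: "smooth_on ?T (\<lambda>x. G (inv_into V \<psi> x) $ i)" if "smooth_map_on A UNIV G"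
      for i and G :: "'p \<Rightarrow> real^4"
    proof -
      have "smooth_on ?T (G \<circ> inv_into V \<psi>)"
        using smooth_map_on_chart[OF that chart] by (rule smooth_on_subset) auto
      from smooth_on_bounded_linear[OF bounded_linear_vec_nth T this] show ?thesis by simp
    qed
    show "smooth_on ?T (\<lambda>x. \<xi> (inv_into V \<psi> x) $ 1)" by (rule comp[OF smooth_\<xi>])
    have sc: "smooth_on ?T (\<lambda>x. c (inv_into V \<psi> x))" and ss: "smooth_on ?T (\<lambda>x. s (inv_into V \<psi> x))"
      unfolding c_def s_def using F3
      by (intro smooth_on_divide smooth_on_mult smooth_on_const comp smooth_F smooth_\<xi> T; simp)+
    have P: "P (inv_into V \<psi> x) \<noteq> 0" if "x \<in> ?T" for x
      using that chart_inv_into[OF atlas chart] by (auto simp: U_def)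
    have sP: "smooth_on ?T (\<lambda>x. P (inv_into V \<psi> x))"
      unfolding P_def by (intro smooth_on_add smooth_on_mult smooth_on_const sc ss T)
    \<comment> \<open>The numerator is written as a sum with the constant factor -sin t to match the
      rules for sums and products.\<close>
    have "smooth_on ?T (\<lambda>x. cos t * s (inv_into V \<psi> x) + (- sin t) * c (inv_into V \<psi> x))"
      by (intro smooth_on_add smooth_on_mult smooth_on_const sc ss T)
    then have "smooth_on ?T (\<lambda>x. cos t * s (inv_into V \<psi> x) - sin t * c (inv_into V \<psi> x))"
      by simp
    from smooth_on_divide[OF T this sP P] show "smooth_on ?T (\<lambda>x. \<theta> (inv_into V \<psi> x))"
      unfolding \<theta>_def by (intro smooth_on_add smooth_on_const smooth_on_arctan T)
  qed
  have "smooth_map_on A U (\<lambda>q. \<xi> q $ 1)" "smooth_map_on A U \<theta>"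
    unfolding smooth_map_on_def comp_def using smooth by blast+
  moreover have "\<xi> q = \<xi> q $ 1 *\<^sub>R axis 1 1 + (F q $ 3 / \<beta> * cos (\<theta> q)) *\<^sub>R axis 3 1
      + (F q $ 3 / \<beta> * sin (\<theta> q)) *\<^sub>R axis 4 1" if "q \<in> U" for q
    using F3[of q] \<beta>_nonzero unfolding \<theta>[OF that] c_def s_def
    by (simp add: vec_eq_iff forall_4 axis_def \<xi>2)
  moreover have "(partial 3 (partial 3 H) (F q) - partial 4 (partial 4 H) (F q)) * sin (2 * \<theta> q)
      = 2 * partial 3 (partial 4 H) (F q) * cos (2 * \<theta> q)" if "q \<in> U" for q
  proof -
    have "g (F q) (\<xi> q) (\<xi> q) \<noteq> 0" using metric_\<xi> \<epsilon> by auto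
    from principal_direction[OF F_in_D \<xi>2 this curvature_normal]
    have "(partial 3 (partial 3 H) (F q) - partial 4 (partial 4 H) (F q)) * (\<xi> q $ 3 * \<xi> q $ 4)
      = partial 3 (partial 4 H) (F q) * ((\<xi> q $ 3)\<^sup>2 - (\<xi> q $ 4)\<^sup>2)" .
    \<comment> \<open>The principal direction equation, multiplied by 2 (\<beta>/x3)^2, turns into
      the double angle formulas 2 s c and c^2 - s^2.\<close>
    moreover have "s q * c q = (\<beta> / F q $ 3)\<^sup>2 * (\<xi> q $ 3 * \<xi> q $ 4)"
      "(c q)\<^sup>2 - (s q)\<^sup>2 = (\<beta> / F q $ 3)\<^sup>2 * ((\<xi> q $ 3)\<^sup>2 - (\<xi> q $ 4)\<^sup>2)"
      by (simp_all add: c_def s_def power2_eq_square diff_divide_distrib right_diff_distrib mult_ac)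
    ultimately show ?thesis
      unfolding sin_double cos_double \<theta>[OF that] by algebra
  qed
  ultimately show ?thesis
    using \<open>open U\<close> \<open>p \<in> U\<close> by blast
qed

end

theorem theorem3p1:
  fixes D :: "(real^4) set"
    and H :: "real^4 \<Rightarrow> real"
    and \<Lambda> \<beta> \<epsilon> :: real
    and A :: "('p::{t2_space, second_countable_topology}, 3) chart set"
    and F \<xi> :: "'p \<Rightarrow> real^4"
    and h :: "'p \<Rightarrow> real^4 \<Rightarrow> real^4 \<Rightarrow> real"
  assumes "siklos_spacetime D H \<Lambda> \<beta>"
    and "hypersurface D (siklos_metric \<beta> H) A F"
    and "\<epsilon> \<in> {-1, 1}"
    and "unit_normal (siklos_metric \<beta> H) A F \<epsilon> \<xi>"
    and "second_fundamental_form (siklos_metric \<beta> H) A F \<xi> h"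
    and "codazzi (siklos_metric \<beta> H) A F h"
    and not_locally_anti_de_Sitter:
      "\<And>p W. \<lbrakk>open W; W \<subseteq> D; F p \<in> W\<rbrakk> \<Longrightarrow> \<not> constant_curvature_on W (siklos_metric \<beta> H)"
  shows "(\<forall>p. \<exists>U (a :: 'p \<Rightarrow> real) (\<theta> :: 'p \<Rightarrow> real).
            open U \<and> p \<in> U \<and> smooth_map_on A U a \<and> smooth_map_on A U \<theta> \<and>
            (\<forall>q\<in>U.
               \<xi> q = a q *\<^sub>R axis 1 1
                    + (F q $ 3 / \<beta> * cos (\<theta> q)) *\<^sub>R axis 3 1
                    + (F q $ 3 / \<beta> * sin (\<theta> q)) *\<^sub>R axis 4 1 \<and>
               (partial 3 (partial 3 H) (F q) - partial 4 (partial 4 H) (F q)) * sin (2 * \<theta> q)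
                 = 2 * partial 3 (partial 4 H) (F q) * cos (2 * \<theta> q)))
         \<and> timelike_hypersurface (siklos_metric \<beta> H) A F \<and> \<epsilon> = 1"
proof -
  interpret siklos_hypersurface D H \<Lambda> \<beta> A F \<xi> \<epsilon> h
    by unfold_locales (fact assms)+
  have "\<xi> p $ 2 = 0" for p
    by (rule \<xi>_2_eq_0[OF not_locally_anti_de_Sitter])
  then show ?thesis
    by (intro conjI allI normal_form timelike \<epsilon>_eq_1)
qed

end
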